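(* Let $\pi$ be a set of primes and let $G$ be a finite group such that $F^{*}(G)$ is a $\pi'$-group. If $x$ is a non-trivial $\pi$-element of $G$ and $q$ is the largest prime dividing $o(x)$, then $$\frac{|C_{G}(x)_{\pi}|}{|G_{\pi}|} \leq \frac{1}{q}.$$
   Context: $F^{*}(G)$ denotes the generalized Fitting subgroup of $G$ (the product of the Fitting subgroup and all components, i.e. subnormal quasisimple subgroups, of $G$). A $\pi'$-group is a finite group whose order is divisible by no prime in $\pi$. A $\pi$-element is an element all of whose order's prime divisors lie in $\pi$ (the identity is a $\pi$-element); for a finite group $H$, $H_{\pi}$ denotes the set of all $\pi$-elements of $H$, so $C_G(x)_\pi$ is the set of $\pi$-elements of the centralizer $C_G(x)$. $o(x)$ is the order of $x$. *)

theory Defs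
  imports
    "HOL-Algebra.Multiplicative_Group"
    "HOL-Algebra.Generated_Groups"
    "HOL-Algebra.SimpleGroups"
begin

definition centralizer :: "('a, 'b) monoid_scheme \<Rightarrow> 'a \<Rightarrow> 'a set" where
  "centralizer G x = {g \<in> carrier G. g \<otimes>\<^bsub>G\<^esub> x = x \<otimes>\<^bsub>G\<^esub> g}"

definition center :: "('a, 'b) monoid_scheme \<Rightarrow> 'a set" where
  "center G = {z \<in> carrier G. \<forall>g\<in>carrier G. z \<otimes>\<^bsub>G\<^esub> g = g \<otimes>\<^bsub>G\<^esub> z}"

(* The subgroup [H, K]; for H = K it is the library's derived G H. *)
definition commutator_subgroup :: "('a, 'b) monoid_scheme \<Rightarrow> 'a set \<Rightarrow> 'a set \<Rightarrow> 'a set" where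
  "commutator_subgroup G H K = generate G
     (\<Union>h\<in>H. \<Union>k\<in>K. {h \<otimes>\<^bsub>G\<^esub> k \<otimes>\<^bsub>G\<^esub> inv\<^bsub>G\<^esub> h \<otimes>\<^bsub>G\<^esub> inv\<^bsub>G\<^esub> k})"

primrec lower_central :: "('a, 'b) monoid_scheme \<Rightarrow> nat \<Rightarrow> 'a set" where
  "lower_central G 0 = carrier G"
| "lower_central G (Suc n) = commutator_subgroup G (lower_central G n) (carrier G)"

definition nilpotent_group :: "('a, 'b) monoid_scheme \<Rightarrow> bool" where
  "nilpotent_group G \<longleftrightarrow> group G \<and> (\<exists>n. lower_central G n = {\<one>\<^bsub>G\<^esub>})"

(* The product of a family of normal subgroups is the subgroup generated by its union. *)
definition fitting :: "('a, 'b) monoid_scheme \<Rightarrow> 'a set" where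
  "fitting G = generate G (\<Union>{N. N \<lhd> G \<and> nilpotent_group (G\<lparr>carrier := N\<rparr>)})"

inductive subnormal :: "('a, 'b) monoid_scheme \<Rightarrow> 'a set \<Rightarrow> bool" for G where
  whole: "subnormal G (carrier G)"
| step: "\<lbrakk> subnormal G K; H \<lhd> (G\<lparr>carrier := K\<rparr>) \<rbrakk> \<Longrightarrow> subnormal G H"

(* simple_group allows prime order, but the central quotient of a perfect group is
   perfect, so that here it is automatically non-abelian. *)
definition quasisimple :: "('a, 'b) monoid_scheme \<Rightarrow> bool" where
  "quasisimple G \<longleftrightarrow>
     group G \<and> derived G (carrier G) = carrier G \<and> simple_group (G Mod center G)"

definition component :: "('a, 'b) monoid_scheme \<Rightarrow> 'a set \<Rightarrow> bool" where
  "component G L \<longleftrightarrow> subnormal G L \<and> quasisimple (G\<lparr>carrier := L\<rparr>)"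

(* Distinct components commute elementwise with one another and with the Fitting subgroup, so their
   product is independent of the order of the factors and is the generated subgroup. *)
definition generalized_fitting :: "('a, 'b) monoid_scheme \<Rightarrow> 'a set" where
  "generalized_fitting G = generate G (fitting G \<union> \<Union>{L. component G L})"

definition pi_complement_group :: "nat set \<Rightarrow> ('a, 'b) monoid_scheme \<Rightarrow> bool" where
  "pi_complement_group \<pi> G \<longleftrightarrow>
     group G \<and> finite (carrier G) \<and> (\<forall>p\<in>\<pi>. \<not> p dvd order G)"

definition pi_elements :: "nat set \<Rightarrow> ('a, 'b) monoid_scheme \<Rightarrow> 'a set" where
  "pi_elements \<pi> G = {x \<in> carrier G. \<forall>p. prime p \<longrightarrow> p dvd group.ord G x \<longrightarrow> p \<in> \<pi>}"

end

theory Submission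
  imports
    Defs
    "HOL-Algebra.Elementary_Groups"
    "HOL-Algebra.Group_Action"
    "HOL-Algebra.SndIsomorphismGrp"
    "HOL-Algebra.Sylow"
begin

text \<open>
  Since \<open>C\<^sub>G(x)\<close> only grows when \<open>x\<close> is replaced by a power, \<open>x\<close> may be taken of prime order \<open>q\<close>.
  By Bender's theorem \<open>x\<close> acts non-trivially on the \<open>q'\<close>-group \<open>F\<^sup>*(G)\<close>, hence on some \<open>x\<close>-invariant
  Sylow \<open>s\<close>-subgroup \<open>S\<close> of it. Let \<open>Q\<close> be the set of \<open>S\<close>-conjugates of \<open>x\<close>, and for \<open>u \<in> G\<^sub>\<pi>\<close> let
  \<open>T(u)\<close> be the set of members of \<open>Q\<close> that commute with \<open>u\<close>. Distinct members of \<open>Q\<close> do not commute, and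
  \<open>C\<^sub>S(u)\<close> is transitive on \<open>T(u)\<close>; therefore \<open>|Q|\<close> and each non-zero \<open>|T(u)|\<close> are powers of \<open>s\<close> congruent
  to 1 modulo \<open>q\<close>, so that either \<open>T(u) = Q\<close> or \<open>(q + 1) |T(u)| \<le> |Q|\<close>. Write \<open>m = |C\<^sub>G(x)\<^sub>\<pi>|\<close> and let \<open>K\<close> be
  the set of those \<open>u\<close> with \<open>T(u) = Q\<close>. Multiplying by the powers of one \<open>X \<in> Q\<close> the \<open>u\<close> that commute
  with both \<open>X\<close> and some other \<open>Y \<in> Q\<close> gives \<open>q |K| \<le> m\<close>. Counting commuting pairs gives
  \<open>\<Sum>\<^sub>u |T(u)| = |Q| m\<close>, whence \<open>|G\<^sub>\<pi>| \<ge> (q + 1) (m - |K|) + |K| \<ge> q m\<close>.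
\<close>

section \<open>Fixed points of actions of prime power order\<close>

text \<open>The library's actions are homomorphisms into \<open>BijGroup E\<close>, whose elements
  are extensional, hence the \<open>restrict\<close>. Bijectivity comes from the action of the
  inverse element.\<close>

lemma (in group) group_action_of_fun:
  assumes closed: "\<And>g e. g \<in> carrier G \<Longrightarrow> e \<in> E \<Longrightarrow> act g e \<in> E"
    and one: "\<And>e. e \<in> E \<Longrightarrow> act \<one> e = e"
    and mult: "\<And>g h e. g \<in> carrier G \<Longrightarrow> h \<in> carrier G \<Longrightarrow> e \<in> E \<Longrightarrow> act (g \<otimes> h) e = act g (act h e)"
  shows "group_action G E (\<lambda>g. restrict (act g) E)"
proof -
  have bij: "bij_betw (restrict (act g) E) E E" if "g \<in> carrier G" for g
  proof (rule bij_betw_byWitness[where f' = "act (inv g)"])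
    show "\<forall>a\<in>E. act (inv g) (restrict (act g) E a) = a"
      using that by (simp flip: mult add: one)
    show "\<forall>a\<in>E. restrict (act g) E (act (inv g) a) = a"
      using that by (simp flip: mult add: one closed)
  qed (use that closed in auto)
  show ?thesis
    unfolding group_action_def group_hom_def group_hom_axioms_def
  proof (intro conjI group_BijGroup is_group homI)
    fix g h assume gh: "g \<in> carrier G" "h \<in> carrier G"
    then show "restrict (act (g \<otimes> h)) E
        = restrict (act g) E \<otimes>\<^bsub>BijGroup E\<^esub> restrict (act h) E"
      using bij by (auto simp: BijGroup_def Bij_def compose_def mult closed fun_eq_iff)
  qed (use bij in \<open>simp add: BijGroup_def Bij_def\<close>)
qed

text \<open>By orbit-stabilizer every orbit has size a power of \<open>p\<close>. Orbits of
  non-fixed points have more than one element, so \<open>p\<close> divides their sizes, and they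
  partition the complement of the fixed-point set.\<close>

lemma (in group) p_group_fixpoints:
  assumes p: "prime p" and ord: "order G = p ^ a" and fin: "finite E"
    and closed: "\<And>g e. g \<in> carrier G \<Longrightarrow> e \<in> E \<Longrightarrow> act g e \<in> E"
    and one: "\<And>e. e \<in> E \<Longrightarrow> act \<one> e = e"
    and mult: "\<And>g h e. g \<in> carrier G \<Longrightarrow> h \<in> carrier G \<Longrightarrow> e \<in> E \<Longrightarrow> act (g \<otimes> h) e = act g (act h e)"
  shows "card E mod p = card {e \<in> E. \<forall>g\<in>carrier G. act g e = e} mod p"
proof -
  define \<phi> where "\<phi> = (\<lambda>g. restrict (act g) E)"
  interpret A: group_action G E \<phi>
    unfolding \<phi>_def using closed one mult by (rule group_action_of_fun)
  have \<phi>: "\<phi> g e = act g e" if "e \<in> E" for g e using that by (simp add: \<phi>_def)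
  let ?F = "{e \<in> E. \<forall>g\<in>carrier G. act g e = e}"
  have orbit_sub: "orbit G \<phi> e \<subseteq> E" if "e \<in> E" for e
    using that closed by (auto simp: orbit_def \<phi>)
  have dv: "p dvd card (orbit G \<phi> e)" if e: "e \<in> E - ?F" for e
  proof -
    have "card (orbit G \<phi> e) dvd p ^ a"
      using A.orbit_stabilizer_theorem[of e] e by (intro dvdI[of _ _ "card (stabilizer G \<phi> e)"]) (simp add: ord)
    then obtain i where i: "card (orbit G \<phi> e) = p ^ i"
      using divides_primepow_nat[OF p] by blast
    have "i \<noteq> 0"
    proof
      assume "i = 0"
      then obtain y where y: "orbit G \<phi> e = {y}" using i by (auto simp: card_1_singleton_iff)
      have "act g e = y" if "g \<in> carrier G" for g
      proof -
        have "\<phi> g e \<in> orbit G \<phi> e" using that unfolding orbit_def by blast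
        then show ?thesis using y e \<phi> by simp
      qed
      moreover have "e = y" using e one[of e] calculation[OF one_closed] by simp
      ultimately show False using e by blast
    qed
    then show ?thesis using i by simp
  qed
  have un: "E - ?F = \<Union> (orbit G \<phi> ` (E - ?F))"
  proof
    show "E - ?F \<subseteq> \<Union> (orbit G \<phi> ` (E - ?F))"
      using A.orbit_refl by blast
    show "\<Union> (orbit G \<phi> ` (E - ?F)) \<subseteq> E - ?F"
    proof
      fix y assume "y \<in> \<Union> (orbit G \<phi> ` (E - ?F))"
      then obtain e where e: "e \<in> E - ?F" and y: "y \<in> orbit G \<phi> e" by blast
      have yE: "y \<in> E" using e y orbit_sub by blast
      have "e \<in> orbit G \<phi> y" using A.orbit_sym e y yE by blast
      then obtain g where g: "g \<in> carrier G" "e = act g y" using yE by (auto simp: orbit_def \<phi>)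
      \<comment> \<open>A fixed point in the orbit of \<open>e\<close> would be all of that orbit
        and thus equal to \<open>e\<close>, which is not fixed.\<close>
      have "y \<notin> ?F"
      proof
        assume F: "y \<in> ?F"
        then have "e = y" using g by simp
        then show False using e F by blast
      qed
      then show "y \<in> E - ?F" using yE by blast
    qed
  qed
  have "p dvd card (\<Union> (orbit G \<phi> ` (E - ?F)))"
  proof (rule dvd_partition)
    show "finite (\<Union> (orbit G \<phi> ` (E - ?F)))" unfolding un[symmetric] using fin by blast
    show "\<forall>c\<in>orbit G \<phi> ` (E - ?F). p dvd card c" using dv by blast
    show "\<forall>c1\<in>orbit G \<phi> ` (E - ?F). \<forall>c2\<in>orbit G \<phi> ` (E - ?F). c1 \<noteq> c2 \<longrightarrow> c1 \<inter> c2 = {}"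
    proof (intro ballI impI)
      fix c1 c2 assume c: "c1 \<in> orbit G \<phi> ` (E - ?F)" "c2 \<in> orbit G \<phi> ` (E - ?F)" "c1 \<noteq> c2"
      then have "c1 \<in> orbits G E \<phi>" "c2 \<in> orbits G E \<phi>" by (auto simp: orbits_def)
      then show "c1 \<inter> c2 = {}" using A.disjoint_union c(3) by blast
    qed
  qed
  then have "p dvd card (E - ?F)" unfolding un[symmetric] .
  then obtain k where "card (E - ?F) = p * k" by (rule dvdE)
  moreover have "card E = card (E - ?F) + card ?F"
    using card_Un_disjoint[of "E - ?F" ?F] fin by (auto simp: Un_absorb2)
  ultimately show ?thesis by simp
qed

text \<open>A map of period \<open>q\<close> is an action of the cyclic group of order
  \<open>q\<close>, whose fixed points are those of the generator 1. Stating this for a bare map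
  covers conjugation by an element with trivial \<open>q\<close>-th power as well as the map d ->
  Y^-1 d X used later, which is not a conjugation.\<close>

lemma funpow_prime_fixpoints:
  assumes q: "prime q" and fin: "finite E" and closed: "\<And>e. e \<in> E \<Longrightarrow> f e \<in> E"
    and iter: "\<And>e. e \<in> E \<Longrightarrow> (f ^^ q) e = e"
  shows "card E mod q = card {e \<in> E. f e = e} mod q"
proof -
  have q1: "q > 1" using q by (rule prime_gt_1_nat)
  interpret Z: group "integer_mod_group q" by simp
  have "card E mod q = card {e \<in> E. \<forall>k\<in>carrier (integer_mod_group q). (f ^^ nat k) e = e} mod q"
  proof (rule Z.p_group_fixpoints[OF q, of 1])
    show "order (integer_mod_group q) = q ^ 1" using q1 by (simp add: order_def carrier_integer_mod_group)
    show "(f ^^ nat k) e \<in> E" if "e \<in> E" for k :: int and e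
    proof -
      have "(f ^^ n) e \<in> E" for n by (induction n) (use that closed in auto)
      then show ?thesis .
    qed
    fix k l and e assume kl: "k \<in> carrier (integer_mod_group q)" "l \<in> carrier (integer_mod_group q)"
      and e: "e \<in> E"
    have kl0: "0 \<le> k" "0 \<le> l" using kl q1 by (auto simp: carrier_integer_mod_group)
    have "nat (k \<otimes>\<^bsub>integer_mod_group q\<^esub> l) = (nat k + nat l) mod q"
      using kl0 by (simp add: nat_mod_distrib nat_add_distrib)
    then show "(f ^^ nat (k \<otimes>\<^bsub>integer_mod_group q\<^esub> l)) e = (f ^^ nat k) ((f ^^ nat l) e)"
      using funpow_mod_eq[OF iter[OF e]] by (simp add: funpow_add)
  qed (use fin in auto)
  moreover have "{e \<in> E. \<forall>k\<in>carrier (integer_mod_group q). (f ^^ nat k) e = e} = {e \<in> E. f e = e}"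
  proof (intro Collect_cong conj_cong refl iffI ballI)
    fix e assume "\<forall>k\<in>carrier (integer_mod_group q). (f ^^ nat k) e = e"
    moreover have "1 \<in> carrier (integer_mod_group q)" using q1 by (simp add: carrier_integer_mod_group)
    ultimately have "(f ^^ nat 1) e = e" by blast
    then show "f e = e" by simp
  next
    fix e k assume "f e = e"
    then have "(f ^^ n) e = e" for n by (induction n) auto
    then show "(f ^^ nat k) e = e" .
  qed
  ultimately show ?thesis by simp
qed

section \<open>Conjugation\<close>

context group
begin

definition conjby :: "'a \<Rightarrow> 'a \<Rightarrow> 'a" where
  "conjby g t = g \<otimes> t \<otimes> inv g"

lemma inv_cancel [simp]:
  assumes "g \<in> carrier G" "h \<in> carrier G"
  shows "inv g \<otimes> (g \<otimes> h) = h" and "g \<otimes> (inv g \<otimes> h) = h"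
  using assms by (simp_all flip: m_assoc)

lemma conjby_closed [simp]: "g \<in> carrier G \<Longrightarrow> t \<in> carrier G \<Longrightarrow> conjby g t \<in> carrier G"
  by (simp add: conjby_def)

lemma conjby_conjby:
  "g \<in> carrier G \<Longrightarrow> h \<in> carrier G \<Longrightarrow> t \<in> carrier G \<Longrightarrow> conjby g (conjby h t) = conjby (g \<otimes> h) t"
  by (simp add: conjby_def m_assoc inv_mult_group)

lemma conjby_one [simp]: "t \<in> carrier G \<Longrightarrow> conjby \<one> t = t"
  by (simp add: conjby_def)

lemma conjby_inv_cancel [simp]:
  assumes "g \<in> carrier G" "t \<in> carrier G"
  shows "conjby (inv g) (conjby g t) = t" and "conjby g (conjby (inv g) t) = t"
  using assms by (simp_all add: conjby_conjby)

lemma conjby_mult: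
  "g \<in> carrier G \<Longrightarrow> s \<in> carrier G \<Longrightarrow> t \<in> carrier G \<Longrightarrow> conjby g (s \<otimes> t) = conjby g s \<otimes> conjby g t"
  by (simp add: conjby_def m_assoc)

lemma conjby_bij: "g \<in> carrier G \<Longrightarrow> bij_betw (conjby g) (carrier G) (carrier G)"
  by (rule bij_betw_byWitness[where f' = "conjby (inv g)"]) auto

lemma conjby_iso: "g \<in> carrier G \<Longrightarrow> conjby g \<in> iso G G"
  by (simp add: iso_def hom_def conjby_bij conjby_mult)

lemma conjby_group_hom: "g \<in> carrier G \<Longrightarrow> group_hom G G (conjby g)"
  using conjby_iso by (simp add: group_hom_def group_hom_axioms_def is_group iso_def)

lemma conjby_pow: "g \<in> carrier G \<Longrightarrow> t \<in> carrier G \<Longrightarrow> conjby g (t [^] (n::nat)) = conjby g t [^] n"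
  by (rule group_hom.hom_nat_pow[OF conjby_group_hom])

lemma conjby_eq_iff_commute:
  "g \<in> carrier G \<Longrightarrow> t \<in> carrier G \<Longrightarrow> conjby g t = t \<longleftrightarrow> g \<otimes> t = t \<otimes> g"
  unfolding conjby_def by (metis inv_solve_right m_closed)

lemma conjby_inj_on: "g \<in> carrier G \<Longrightarrow> A \<subseteq> carrier G \<Longrightarrow> inj_on (conjby g) A"
  using conjby_bij inj_on_subset bij_betw_def by metis

lemma conjby_image_mult:
  "g \<in> carrier G \<Longrightarrow> h \<in> carrier G \<Longrightarrow> A \<subseteq> carrier G \<Longrightarrow>
    conjby g ` conjby h ` A = conjby (g \<otimes> h) ` A"
  unfolding image_image by (intro image_cong) (auto simp: conjby_conjby)

lemma conjby_image_one: "A \<subseteq> carrier G \<Longrightarrow> conjby \<one> ` A = A"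
  by force

lemma normalI_conjby:
  assumes "subgroup N G" "\<And>g n. g \<in> carrier G \<Longrightarrow> n \<in> N \<Longrightarrow> conjby g n \<in> N"
  shows "N \<lhd> G"
  using assms by (simp add: normal_inv_iff conjby_def)

lemma normal_conjby: "N \<lhd> G \<Longrightarrow> g \<in> carrier G \<Longrightarrow> n \<in> N \<Longrightarrow> conjby g n \<in> N"
  by (simp add: conjby_def normal.inv_op_closed2)

lemma subgroup_conjby: "subgroup H G \<Longrightarrow> g \<in> H \<Longrightarrow> h \<in> H \<Longrightarrow> conjby g h \<in> H"
  by (simp add: conjby_def subgroup.m_closed subgroup.m_inv_closed)

lemma subgroup_conjby_image: "g \<in> carrier G \<Longrightarrow> subgroup H G \<Longrightarrow> subgroup (conjby g ` H) G"
  by (rule group_hom.subgroup_img_is_subgroup[OF conjby_group_hom])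

lemma conjby_image_normal:
  assumes "N \<lhd> G" "g \<in> carrier G"
  shows "conjby g ` N = N"
proof
  show "conjby g ` N \<subseteq> N" using assms normal_conjby by blast
  have N: "N \<subseteq> carrier G" using assms normal_imp_subgroup subgroup.subset by blast
  show "N \<subseteq> conjby g ` N"
  proof
    fix n assume n: "n \<in> N"
    then have "n = conjby g (conjby (inv g) n)" using assms N by auto
    moreover have "conjby (inv g) n \<in> N" using assms n normal_conjby by blast
    ultimately show "n \<in> conjby g ` N" by blast
  qed
qed

lemma conjby_consistent:
  assumes "subgroup H G" "g \<in> H"
  shows "group.conjby (G\<lparr>carrier := H\<rparr>) g t = conjby g t"
  using assms by (simp add: group.conjby_def[OF subgroup_imp_group] conjby_def)

lemma card_conjby_image: "g \<in> carrier G \<Longrightarrow> A \<subseteq> carrier G \<Longrightarrow> card (conjby g ` A) = card A"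
  by (rule card_image[OF conjby_inj_on])

lemma center_iff: "z \<in> center G \<longleftrightarrow> z \<in> carrier G \<and> (\<forall>g\<in>carrier G. conjby g z = z)"
proof (cases "z \<in> carrier G")
  case True
  then have "z \<otimes> g = g \<otimes> z \<longleftrightarrow> conjby g z = z" if "g \<in> carrier G" for g
    using conjby_eq_iff_commute[OF that True] by (simp add: eq_commute)
  then show ?thesis by (simp add: center_def True)
qed (simp add: center_def)

lemma center_subgroup: "subgroup (center G) G"
proof (rule subgroupI)
  fix a assume "a \<in> center G"
  then have a: "a \<in> carrier G" "\<And>g. g \<in> carrier G \<Longrightarrow> conjby g a = a"
    by (simp_all add: center_iff)
  have "conjby g (inv a) = inv a" if "g \<in> carrier G" for g
    using group_hom.hom_inv[OF conjby_group_hom] a that by simp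
  then show "inv a \<in> center G" using a by (simp add: center_iff)
next
  fix a b assume "a \<in> center G" "b \<in> center G"
  then have ab: "a \<in> carrier G" "b \<in> carrier G"
    "\<And>g. g \<in> carrier G \<Longrightarrow> conjby g a = a" "\<And>g. g \<in> carrier G \<Longrightarrow> conjby g b = b"
    by (simp_all add: center_iff)
  have "conjby g (a \<otimes> b) = a \<otimes> b" if "g \<in> carrier G" for g
    using ab that by (simp add: conjby_mult)
  then show "a \<otimes> b \<in> center G" using ab by (simp add: center_iff)
next
  have "\<one> \<in> center G" by (simp add: center_iff conjby_def)
  then show "center G \<noteq> {}" by blast
qed (simp add: center_iff subset_iff)

lemma conjby_center: "z \<in> center G \<Longrightarrow> g \<in> carrier G \<Longrightarrow> conjby g z = z"
  by (simp add: center_iff)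

lemma subgroup_of_center_normal: "subgroup N G \<Longrightarrow> N \<subseteq> center G \<Longrightarrow> N \<lhd> G"
  by (rule normalI_conjby) (auto simp: conjby_center subsetD)

lemma center_normal: "center G \<lhd> G"
  by (simp add: center_subgroup subgroup_of_center_normal)

lemma subgroup_restrict_iff:
  assumes "subgroup H G"
  shows "subgroup K (G\<lparr>carrier := H\<rparr>) \<longleftrightarrow> subgroup K G \<and> K \<subseteq> H"
proof
  assume K: "subgroup K (G\<lparr>carrier := H\<rparr>)"
  show "subgroup K G \<and> K \<subseteq> H"
    using incl_subgroup[OF assms K] subgroup.subset[OF K] by simp
qed (use assms subgroup_incl in blast)

text \<open>This rule and the next express the links of a subnormal chain by conjugation in the
  ambient group, so that computations never have to take place in a restricted structure.\<close>

lemma restrict_normalI: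
  assumes H: "subgroup H G" and K: "subgroup K G" "K \<subseteq> H"
    and conj: "\<And>h k. h \<in> H \<Longrightarrow> k \<in> K \<Longrightarrow> conjby h k \<in> K"
  shows "K \<lhd> G\<lparr>carrier := H\<rparr>"
proof (rule group.normalI_conjby[OF subgroup_imp_group[OF H]])
  show "subgroup K (G\<lparr>carrier := H\<rparr>)" using H K by (simp add: subgroup_restrict_iff)
  fix g n assume "g \<in> carrier (G\<lparr>carrier := H\<rparr>)" "n \<in> K"
  then show "group.conjby (G\<lparr>carrier := H\<rparr>) g n \<in> K"
    using conj by (simp add: conjby_consistent[OF H])
qed

lemma restrict_normalD:
  assumes H: "subgroup H G" and K: "K \<lhd> G\<lparr>carrier := H\<rparr>"
  shows "subgroup K G" "K \<subseteq> H" "\<And>h k. h \<in> H \<Longrightarrow> k \<in> K \<Longrightarrow> conjby h k \<in> K"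
proof -
  show "subgroup K G" "K \<subseteq> H"
    using normal_imp_subgroup[OF K] by (simp_all add: subgroup_restrict_iff[OF H])
  fix h k assume hk: "h \<in> H" "k \<in> K"
  then have "group.conjby (G\<lparr>carrier := H\<rparr>) h k \<in> K"
    by (intro group.normal_conjby[OF subgroup_imp_group[OF H] K]) simp
  then show "conjby h k \<in> K" using hk by (simp add: conjby_consistent[OF H])
qed

end

lemma (in group_hom) normal_preimage:
  assumes "N \<lhd> H"
  shows "{g \<in> carrier G. h g \<in> N} \<lhd> G"
proof -
  let ?K = "{g \<in> carrier G. h g \<in> N}"
  have N: "subgroup N H" by (rule normal_imp_subgroup[OF assms])
  note closed = subgroup.one_closed[OF N] subgroup.m_closed[OF N] subgroup.m_inv_closed[OF N]
  have "subgroup ?K G"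
  proof (rule G.subgroupI)
    have "\<one>\<^bsub>G\<^esub> \<in> ?K" using closed by simp
    then show "?K \<noteq> {}" by blast
  next
    fix a assume "a \<in> ?K"
    then show "inv\<^bsub>G\<^esub> a \<in> ?K" using closed by simp
  next
    fix a b assume "a \<in> ?K" "b \<in> ?K"
    then show "a \<otimes>\<^bsub>G\<^esub> b \<in> ?K" using closed by simp
  qed blast
  moreover have "G.conjby g n \<in> ?K" if "g \<in> carrier G" "n \<in> ?K" for g n
    using H.normal_conjby[OF assms, of "h g" "h n"] that by (simp add: G.conjby_def H.conjby_def)
  ultimately show ?thesis by (rule G.normalI_conjby)
qed

lemma (in normal) Mod_group_hom: "group_hom G (G Mod H) (\<lambda>a. H #> a)"
  by (simp add: group_hom_def group_hom_axioms_def is_group factorgroup_is_group r_coset_hom_Mod)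

lemma (in normal) rcos_eq_self_iff: "a \<in> carrier G \<Longrightarrow> H #> a = H \<longleftrightarrow> a \<in> H"
  using coset_join1 coset_join2 subgroup_axioms by blast

section \<open>Groups of prime power order\<close>

text \<open>A condition on elements rather than on the order: it passes to products and conjugates
  without counting, and it reads the same in a restricted structure. For finite groups and prime
  \<open>p\<close> it forces the order to be a power of \<open>p\<close>, see
  \<open>p_torsion_order\<close>.\<close>

definition p_torsion :: "('a, 'b) monoid_scheme \<Rightarrow> nat \<Rightarrow> 'a set \<Rightarrow> bool" where
  "p_torsion G p A \<longleftrightarrow> (\<forall>x\<in>A. \<exists>k. x [^]\<^bsub>G\<^esub> (p ^ k) = \<one>\<^bsub>G\<^esub>)"

lemma prime_power_if_only_prime_factor:
  fixes n :: nat
  assumes "n > 0" "prime p" "\<And>r. prime r \<Longrightarrow> r dvd n \<Longrightarrow> r = p"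
  shows "\<exists>a. n = p ^ a"
proof -
  obtain m where m: "n = p ^ multiplicity p n * m" "\<not> p dvd m"
    using multiplicity_decompose'[of n p] assms(1,2) by (metis not_prime_unit gr_implies_not0)
  have "m = 1"
  proof (rule ccontr)
    assume "m \<noteq> 1"
    then obtain r where r: "prime r" "r dvd m" using prime_factor_nat by blast
    then have "r dvd n" by (subst m(1)) (rule dvd_mult)
    then show False using assms(3)[OF r(1)] r(2) m(2) by blast
  qed
  then have "n = p ^ multiplicity p n" using m(1) by simp
  then show ?thesis ..
qed

context group
begin

text \<open>The library's Sylow theorem also provides subgroups of non-maximal prime power order.
  Exponent 1 gives a subgroup of order \<open>r\<close>, any non-identity element of which will
  do.\<close>

lemma cauchy:
  assumes "finite (carrier G)" "prime r" "r dvd order G"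
  obtains y where "y \<in> carrier G" "y \<noteq> \<one>" "y [^] r = \<one>"
proof -
  obtain m where "order G = r ^ 1 * m" using assms(3) by auto
  from sylow_thm[OF assms(2) is_group this assms(1)]
  obtain H where H: "subgroup H G" "card H = r" by auto
  have "H \<noteq> {\<one>}" using H(2) prime_gt_1_nat[OF assms(2)] by auto
  then obtain y where y: "y \<in> H" "y \<noteq> \<one>" using subgroup.one_closed[OF H(1)] by blast
  have "y [^]\<^bsub>G\<lparr>carrier := H\<rparr>\<^esub> order (G\<lparr>carrier := H\<rparr>) = \<one>\<^bsub>G\<lparr>carrier := H\<rparr>\<^esub>"
    by (rule group.pow_order_eq_1[OF subgroup_imp_group[OF H(1)]]) (simp add: y)
  then have "y [^] r = \<one>" using H(2) by (simp add: order_def flip: nat_pow_consistent)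
  then show thesis using that y subgroup.mem_carrier[OF H(1)] by blast
qed

lemma p_torsion_order:
  assumes "finite (carrier G)" "prime p" "p_torsion G p (carrier G)"
  shows "\<exists>a. order G = p ^ a"
proof (rule prime_power_if_only_prime_factor)
  show "order G > 0" using assms(1) order_gt_0_iff_finite by blast
  fix r assume r: "prime r" "r dvd order G"
  obtain y where y: "y \<in> carrier G" "y \<noteq> \<one>" "y [^] r = \<one>" using cauchy[OF assms(1) r] .
  obtain k where k: "y [^] (p ^ k) = \<one>" using assms(3) y(1) by (auto simp: p_torsion_def)
  have "ord y dvd r" "ord y dvd p ^ k" using y k by (simp_all flip: pow_eq_id)
  moreover have "ord y \<noteq> 1" using y ord_eq_1 by blast
  ultimately have "ord y = r" using r(1) by (metis prime_nat_iff)
  then show "r = p" using \<open>ord y dvd p ^ k\<close> r(1) assms(2) prime_dvd_power primes_dvd_imp_eq by metis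
qed (fact assms)

text \<open>Class equation: the fixed points of conjugation form the center, so \<open>p\<close>
  divides its size.\<close>

lemma p_group_center_nontrivial:
  assumes "prime p" "order G = p ^ a" "a > 0"
  shows "\<exists>z\<in>center G. z \<noteq> \<one>"
proof -
  have fin: "finite (carrier G)"
    using assms order_gt_0_iff_finite by (simp add: prime_gt_0_nat)
  have "card (carrier G) mod p = card {e \<in> carrier G. \<forall>g\<in>carrier G. conjby g e = e} mod p"
    by (rule p_group_fixpoints[OF assms(1,2) fin]) (simp_all add: conjby_conjby)
  also have "{e \<in> carrier G. \<forall>g\<in>carrier G. conjby g e = e} = center G"
    by (auto simp: center_iff)
  finally have "p dvd card (center G)"
    using assms by (simp add: order_def mod_eq_0_iff_dvd)
  moreover have "finite (center G)" using fin by (rule finite_subset[rotated]) (auto simp: center_iff)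
  ultimately have "center G \<noteq> {\<one>}" using prime_gt_1_nat[OF assms(1)] by auto
  then show ?thesis using subgroup.one_closed[OF center_subgroup] by blast
qed

text \<open>Induction from the top, starting at \<open>U = carrier G\<close>. The preimage
  \<open>V\<close> of the center of G/U is strictly larger than \<open>U\<close> and satisfies
  [V, G] <= U, so one step after the series has entered \<open>V\<close> it is inside
  \<open>U\<close>. The trivial subgroup as \<open>U\<close> then gives nilpotency.\<close>

lemma p_group_lower_central_subset:
  assumes "prime p" "order G = p ^ a" "U \<lhd> G"
  shows "\<exists>n. lower_central G n \<subseteq> U"
  using assms(3)
proof (induction "order G - card U" arbitrary: U rule: less_induct)
  case less
  interpret U: normal U G by (rule less.prems)
  have fin: "finite (carrier G)"
    using assms order_gt_0_iff_finite by (simp add: prime_gt_0_nat)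
  show ?case
  proof (cases "U = carrier G")
    case True
    then show ?thesis by (intro exI[of _ 0]) simp
  next
    case False
    let ?Q = "G Mod U"
    interpret Q: group ?Q by (rule U.factorgroup_is_group)
    interpret h: group_hom G ?Q "\<lambda>a. U #> a" by (rule U.Mod_group_hom)
    have index: "order ?Q * card U = p ^ a"
      using lagrange[OF U.subgroup_axioms] assms(2) by (simp add: order_def FactGroup_def)
    then have "order ?Q dvd p ^ a" by (metis dvd_triv_left)
    then obtain b where b: "order ?Q = p ^ b" using divides_primepow_nat[OF assms(1)] by blast
    have "b \<noteq> 0"
    proof
      assume "b = 0"
      then have "card U = card (carrier G)" using b index assms(2) by (simp add: order_def)
      then show False using card_subset_eq[OF fin U.subset] False by blast
    qed
    then obtain Z where Z: "Z \<in> center ?Q" "Z \<noteq> U"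
      using Q.p_group_center_nontrivial[OF assms(1) b] by auto
    define V where "V = {g \<in> carrier G. U #> g \<in> center ?Q}"
    have V: "V \<lhd> G" unfolding V_def by (rule h.normal_preimage[OF Q.center_normal])
    have "Z \<in> carrier ?Q" using Z(1) by (simp add: Q.center_iff)
    then obtain z where z: "z \<in> carrier G" "Z = U #> z" by (auto simp: carrier_FactGroup)
    have "z \<in> V" "z \<notin> U" using z Z U.rcos_eq_self_iff[OF z(1)] by (simp_all add: V_def)
    moreover have "U \<subseteq> V"
    proof
      fix u assume u: "u \<in> U"
      have "U \<in> center ?Q" using subgroup.one_closed[OF Q.center_subgroup] by simp
      then show "u \<in> V" using u U.rcos_eq_self_iff[of u] by (simp add: V_def)
    qed
    ultimately have "U \<subset> V" by blast
    moreover have VG: "V \<subseteq> carrier G" by (auto simp: V_def)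
    ultimately have "card U < card V" using fin finite_subset psubset_card_mono by metis
    moreover have "card V \<le> order G" unfolding order_def by (rule card_mono[OF fin VG])
    ultimately have "order G - card V < order G - card U" by simp
    from less.hyps[OF this V] obtain n where n: "lower_central G n \<subseteq> V" by blast
    have "h \<otimes> k \<otimes> inv h \<otimes> inv k \<in> U" if hk: "h \<in> V" "k \<in> carrier G" for h k
    proof -
      have hG: "h \<in> carrier G" "U #> h \<in> center ?Q" using hk by (auto simp: V_def)
      have "(U #> h) <#> (U #> k) = (U #> k) <#> (U #> h)"
        using hG hk h.hom_closed[of k] by (simp add: center_def)
      then have eq: "U #> (h \<otimes> k) = U #> (k \<otimes> h)"
        by (simp only: U.rcos_sum[OF hG(1) hk(2)] U.rcos_sum[OF hk(2) hG(1)])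
      have "h \<otimes> k \<in> U #> (k \<otimes> h)"
        unfolding eq[symmetric] using hG(1) hk(2) by (intro rcos_self U.subgroup_axioms m_closed)
      then have "h \<otimes> k \<otimes> inv (k \<otimes> h) \<in> U"
        using hG(1) hk(2) by (intro U.rcos_module_imp[OF is_group] m_closed)
      then show ?thesis using hG hk by (simp add: inv_mult_group m_assoc)
    qed
    then have "lower_central G (Suc n) \<subseteq> U"
      using n unfolding lower_central.simps commutator_subgroup_def
      by (intro generate_subgroup_incl U.subgroup_axioms) blast
    then show ?thesis ..
  qed
qed

lemma p_group_nilpotent:
  assumes "prime p" "order G = p ^ a"
  shows "nilpotent_group G"
proof -
  obtain n where n: "lower_central G n \<subseteq> {\<one>}"
    using p_group_lower_central_subset[OF assms one_is_normal] by blast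
  have "\<one> \<in> lower_central G n" for n
    by (cases n) (auto simp: commutator_subgroup_def intro: generate.one)
  then show ?thesis using n unfolding nilpotent_group_def by blast
qed

end

section \<open>Invariant Sylow subgroups\<close>

context group
begin

text \<open>The \<open>s\<close>-group \<open>T\<close> acts on the right cosets of \<open>S\<close>
  by right translation, where the inverse makes it a left action. Their number is prime to
  \<open>s\<close>, so some coset S n is fixed; S n t = S n says that n t n^-1 lies in
  \<open>S\<close>.\<close>

lemma p_subgroup_conj_into_sylow:
  assumes fin: "finite (carrier G)" and s: "prime s"
    and S: "subgroup S G" "\<not> s dvd card (rcosets S)" and T: "subgroup T G" "card T = s ^ b"
  shows "\<exists>n\<in>carrier G. conjby n ` T \<subseteq> S"
proof -
  interpret T: group "G\<lparr>carrier := T\<rparr>" by (rule subgroup_imp_group[OF T(1)])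
  have SG: "S \<subseteq> carrier G" by (rule subgroup.subset[OF S(1)])
  have TG: "t \<in> carrier G" if "t \<in> T" for t using subgroup.mem_carrier[OF T(1) that] .
  have rc: "C \<subseteq> carrier G" if "C \<in> rcosets S" for C
    using subgroup.rcosets_carrier[OF S(1) is_group that] .
  have "card (rcosets S) mod s
      = card {C \<in> rcosets S. \<forall>t\<in>carrier (G\<lparr>carrier := T\<rparr>). C #> inv t = C} mod s"
  proof (rule T.p_group_fixpoints[OF s, of b])
    show "order (G\<lparr>carrier := T\<rparr>) = s ^ b" using T(2) by (simp add: order_def)
    show "finite (rcosets S)"
      using fin rcosets_subset_PowG[OF S(1)] by (meson finite_Pow_iff finite_subset)
    show "C #> inv t \<in> rcosets S" if t: "t \<in> carrier (G\<lparr>carrier := T\<rparr>)" and C: "C \<in> rcosets S" for t C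
    proof -
      obtain a where a: "a \<in> carrier G" "C = S #> a" using C by (auto simp: RCOSETS_def)
      then show ?thesis using t TG SG by (auto simp: coset_mult_assoc intro!: rcosetsI)
    qed
    show "C #> inv \<one>\<^bsub>G\<lparr>carrier := T\<rparr>\<^esub> = C" if "C \<in> rcosets S" for C
      using rc[OF that] by simp
    show "C #> inv (t \<otimes>\<^bsub>G\<lparr>carrier := T\<rparr>\<^esub> u) = C #> inv u #> inv t"
      if "t \<in> carrier (G\<lparr>carrier := T\<rparr>)" "u \<in> carrier (G\<lparr>carrier := T\<rparr>)" "C \<in> rcosets S" for t u C
      using that TG rc by (simp add: coset_mult_assoc inv_mult_group)
  qed
  then have "{C \<in> rcosets S. \<forall>t\<in>carrier (G\<lparr>carrier := T\<rparr>). C #> inv t = C} \<noteq> {}"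
    using S(2) by (metis card.empty dvd_eq_mod_eq_0 mod_0)
  then obtain C where C: "C \<in> rcosets S" "\<And>t. t \<in> T \<Longrightarrow> C #> inv t = C" by auto
  obtain n where n: "n \<in> carrier G" "C = S #> n" using C(1) by (auto simp: RCOSETS_def)
  have "conjby n t \<in> S" if t: "t \<in> T" for t
  proof -
    have tT: "inv t \<in> T" using t subgroup.m_inv_closed[OF T(1)] by blast
    have "S #> (n \<otimes> t) = S #> n"
      using C(2)[OF tT] n t TG SG by (simp add: coset_mult_assoc)
    then have "n \<otimes> t \<in> S #> n"
      using n(1) TG[OF t] rcos_self[OF _ S(1), of "n \<otimes> t"] by simp
    then show ?thesis
      unfolding conjby_def by (rule subgroup.rcos_module_imp[OF S(1) is_group n(1)])
  qed
  then show ?thesis using n(1) by blast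
qed

lemma conjby_funpow:
  "x \<in> carrier G \<Longrightarrow> t \<in> carrier G \<Longrightarrow> (conjby x ^^ n) t = conjby (x [^] n) t"
  by (induction n) (simp_all add: conjby_conjby nat_pow_Suc2[symmetric] del: nat_pow_Suc Group.nat_pow_Suc)

lemma conjby_image_funpow:
  "x \<in> carrier G \<Longrightarrow> A \<subseteq> carrier G \<Longrightarrow> ((`) (conjby x) ^^ n) A = conjby (x [^] n) ` A"
  by (induction n) (simp_all add: conjby_image_one conjby_image_mult nat_pow_Suc2[symmetric] del: nat_pow_Suc Group.nat_pow_Suc)

text \<open>\<open>N\<close> permutes its Sylow \<open>s\<close>-subgroups transitively, so their
  number divides \<open>card N\<close> and is prime to \<open>q\<close>. Conjugation by
  \<open>x\<close> permutes them with trivial \<open>q\<close>-th power and therefore fixes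
  one.\<close>

lemma invariant_sylow:
  assumes fin: "finite (carrier G)" and N: "N \<lhd> G" and q: "prime q" "\<not> q dvd card N"
    and x: "x \<in> carrier G" "x [^] q = \<one>" and s: "prime s"
  shows "\<exists>S. subgroup S G \<and> S \<subseteq> N \<and> card S = s ^ multiplicity s (card N) \<and> conjby x ` S = S"
proof -
  define m where "m = multiplicity s (card N)"
  define E where "E = {S. subgroup S G \<and> S \<subseteq> N \<and> card S = s ^ m}"
  let ?N = "G\<lparr>carrier := N\<rparr>"
  have NG: "subgroup N G" using N by (rule normal_imp_subgroup)
  have NC: "N \<subseteq> carrier G" using NG by (rule subgroup.subset)
  interpret N: group ?N by (rule subgroup_imp_group[OF NG])
  have finN: "finite N" using NC fin finite_subset by blast
  then have N0: "card N > 0" using subgroup.one_closed[OF NG] card_gt_0_iff by blast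
  obtain k where k: "card N = s ^ m * k" "\<not> s dvd k"
    using multiplicity_decompose'[of "card N" s] N0 s unfolding m_def
    by (metis not_prime_unit gr_implies_not0)
  have E_conj: "conjby g ` S \<in> E" if "g \<in> carrier G" "S \<in> E" for g S
  proof -
    have "conjby g ` S \<subseteq> conjby g ` N" using that by (auto simp: E_def)
    moreover have "S \<subseteq> carrier G" using that by (simp add: E_def subgroup.subset)
    ultimately show ?thesis
      using that conjby_image_normal[OF N that(1)]
      by (simp add: E_def subgroup_conjby_image card_conjby_image)
  qed
  have EC: "S \<subseteq> carrier G" if "S \<in> E" for S using that by (simp add: E_def subgroup.subset)
  have finE: "finite E" by (rule finite_subset[of _ "Pow N"]) (auto simp: E_def finN)
  obtain S where "subgroup S ?N" "card S = s ^ m"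
    using sylow_thm[OF s N.is_group, of m k] k finN by (auto simp: order_def)
  then have S: "S \<in> E" "subgroup S ?N" by (auto simp: E_def subgroup_restrict_iff[OF NG])
  define \<phi> where "\<phi> = (\<lambda>g. restrict (\<lambda>A. conjby g ` A) E)"
  interpret A: group_action ?N E \<phi>
    unfolding \<phi>_def
  proof (rule N.group_action_of_fun)
    show "conjby \<one>\<^bsub>?N\<^esub> ` A = A" if "A \<in> E" for A
      using conjby_image_one[OF EC[OF that]] by simp
    show "conjby (g \<otimes>\<^bsub>?N\<^esub> h) ` A = conjby g ` conjby h ` A"
      if "g \<in> carrier ?N" "h \<in> carrier ?N" "A \<in> E" for g h A
      using that EC NC by (simp add: conjby_image_mult subsetD)
  qed (use E_conj NC in auto)
  have "orbit ?N \<phi> S = E"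
  proof
    show "orbit ?N \<phi> S \<subseteq> E" using S E_conj NC by (auto simp: orbit_def \<phi>_def)
    show "E \<subseteq> orbit ?N \<phi> S"
    proof
      fix T assume T: "T \<in> E"
      \<comment> \<open>The index of \<open>S\<close> in \<open>N\<close> is the part
        \<open>k\<close> of \<open>card N\<close> prime to \<open>s\<close>. So an
        \<open>N\<close>-conjugate of \<open>T\<close> lies in \<open>S\<close>, and it equals
        \<open>S\<close> by cardinality.\<close>
      have "card (rcosets\<^bsub>?N\<^esub> S) * s ^ m = s ^ m * k"
        using N.lagrange[OF S(2)] S(1) k by (simp add: order_def E_def)
      then have "card (rcosets\<^bsub>?N\<^esub> S) = k" using prime_gt_0_nat[OF s] by simp
      then have "\<exists>n\<in>carrier ?N. N.conjby n ` T \<subseteq> S"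
        using k(2) T finN by (intro N.p_subgroup_conj_into_sylow[OF _ s S(2), of _ m])
          (auto simp: E_def subgroup_restrict_iff[OF NG])
      then obtain n where n: "n \<in> N" "conjby n ` T \<subseteq> S"
        by (auto simp: conjby_consistent[OF NG])
      have nC: "n \<in> carrier G" using n NC by blast
      have "card (conjby n ` T) = card S"
        using T S(1) EC nC by (simp add: E_def card_conjby_image)
      moreover have "finite S" using S(1) finN finite_subset by (auto simp: E_def)
      ultimately have "conjby n ` T = S" using n(2) card_subset_eq by blast
      then have "conjby (inv n) ` S = T"
        using conjby_image_mult[of "inv n" n T] nC EC[OF T] conjby_image_one by auto
      moreover have "inv n \<in> carrier ?N" using n subgroup.m_inv_closed[OF NG] by simp
      ultimately show "T \<in> orbit ?N \<phi> S" using S(1) unfolding orbit_def \<phi>_def by auto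
    qed
  qed
  then have "card E * card (stabilizer ?N \<phi> S) = card N"
    using A.orbit_stabilizer_theorem[OF S(1)] by (simp add: order_def)
  then have "\<not> q dvd card E" using q(2) by (metis dvd_mult2)
  moreover have "card E mod q = card {A \<in> E. conjby x ` A = A} mod q"
  proof (rule funpow_prime_fixpoints[OF q(1) finE])
    show "((`) (conjby x) ^^ q) A = A" if "A \<in> E" for A
      using conjby_image_funpow[OF x(1) EC[OF that], of q] conjby_image_one[OF EC[OF that]] x(2) by simp
  qed (use E_conj x in auto)
  ultimately have "{A \<in> E. conjby x ` A = A} \<noteq> {}" by (metis card.empty dvd_eq_mod_eq_0 mod_0)
  then show ?thesis by (auto simp: E_def m_def)
qed

text \<open>Otherwise the subgroup \<open>C\<close> of points of \<open>N\<close> fixed by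
  \<open>x\<close> contains an \<open>x\<close>-invariant Sylow \<open>s\<close>-subgroup of
  \<open>N\<close> for every prime \<open>s\<close>. Comparing multiplicities prime by prime,
  \<open>card N\<close> divides \<open>card C\<close>, whence C = N, against the moved point
  \<open>n\<close>.\<close>

lemma coprime_action_nontrivial_on_prime_power_subgroup:
  assumes fin: "finite (carrier G)" and N: "N \<lhd> G" and q: "prime q" "\<not> q dvd card N"
    and x: "x \<in> carrier G" "x [^] q = \<one>" and nontriv: "n \<in> N" "conjby x n \<noteq> n"
  obtains s k S t where "prime s" "s \<noteq> q" "subgroup S G" "card S = s ^ k" "conjby x ` S = S"
    "t \<in> S" "conjby x t \<noteq> t"
proof (rule ccontr)
  note thesisI = that
  assume contra: "\<not> thesis"
  have NG: "subgroup N G" using N by (rule normal_imp_subgroup)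
  have NC: "N \<subseteq> carrier G" using NG by (rule subgroup.subset)
  have finN: "finite N" using NC fin finite_subset by blast
  then have N0: "card N > 0" using subgroup.one_closed[OF NG] card_gt_0_iff by blast
  define C where "C = {n \<in> N. conjby x n = n}"
  interpret h: group_hom G G "conjby x" by (rule conjby_group_hom[OF x(1)])
  have C: "subgroup C G"
  proof (rule subgroupI)
    have "\<one> \<in> C" using subgroup.one_closed[OF NG] by (simp add: C_def)
    then show "C \<noteq> {}" by blast
  qed (use NC subgroup.m_closed[OF NG] subgroup.m_inv_closed[OF NG] in \<open>auto simp: C_def subset_iff\<close>)
  have "finite C" using finN by (simp add: C_def)
  then have C0: "card C > 0" using subgroup.one_closed[OF C] card_gt_0_iff by blast
  have "multiplicity s (card N) \<le> multiplicity s (card C)" if s: "prime s" for s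
  proof -
    let ?m = "multiplicity s (card N)"
    obtain S where S: "subgroup S G" "S \<subseteq> N" "card S = s ^ ?m" "conjby x ` S = S"
      using invariant_sylow[OF fin N q x s] by blast
    have "conjby x t = t" if t: "t \<in> S" for t
    proof (rule ccontr)
      assume nt: "conjby x t \<noteq> t"
      \<comment> \<open>For s = q the Sylow subgroup is trivial, because \<open>q\<close> does not
        divide \<open>card N\<close>, and so it contains no moved point.\<close>
      have sq: "s \<noteq> q"
      proof
        assume "s = q"
        then have "card S = 1" using S(3) q(2) by (simp add: not_dvd_imp_multiplicity_0)
        then have "S = {\<one>}" using subgroup.one_closed[OF S(1)] card_1_singletonE by blast
        then show False using t nt by simp
      qed
      have thesis by (rule thesisI[OF s sq S(1,3,4) t nt])
      with contra show False ..
    qed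
    then have SC: "S \<subseteq> C" using S(2) by (auto simp: C_def)
    then have "subgroup S (G\<lparr>carrier := C\<rparr>)" using S(1) by (simp add: subgroup_restrict_iff[OF C])
    then have "card S dvd order (G\<lparr>carrier := C\<rparr>)"
      using group.lagrange[OF subgroup_imp_group[OF C]] dvd_triv_right by metis
    then have "s ^ ?m dvd card C" using S(3) by (simp add: order_def)
    moreover have "\<not> is_unit s" using s not_prime_unit by blast
    ultimately show ?thesis using C0 by (intro multiplicity_geI) auto
  qed
  then have "card N dvd card C"
    using N0 by (intro multiplicity_le_imp_dvd) auto
  then have "card N \<le> card C"
    using C0 by (rule dvd_imp_le)
  then have "C = N" using finN by (intro card_seteq) (auto simp: C_def)
  then show False using nontriv by (auto simp: C_def)
qed

end

section \<open>The largest normal subgroup of prime power order\<close>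

text \<open>This is O_p(G). A plain union suffices instead of a generated subgroup, because the
  product of two normal \<open>p\<close>-torsion subgroups is again one.\<close>

definition p_core :: "('a, 'b) monoid_scheme \<Rightarrow> nat \<Rightarrow> 'a set" where
  "p_core G p = \<Union>{P. P \<lhd> G \<and> p_torsion G p P}"

lemma p_torsion_restrict [simp]: "p_torsion (G\<lparr>carrier := H\<rparr>) p A = p_torsion G p A"
  by (simp add: p_torsion_def nat_pow_def)

context group
begin

lemma mult_pow_in_normal_coset:
  assumes "P \<lhd> G" "a \<in> P" "b \<in> carrier G"
  shows "\<exists>c\<in>P. (a \<otimes> b) [^] (n::nat) = c \<otimes> b [^] n"
proof (induction n)
  case 0
  then show ?case using subgroup.one_closed[OF normal_imp_subgroup[OF assms(1)]] by force
next
  case (Suc n)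
  interpret P: normal P G by (rule assms(1))
  obtain c where c: "c \<in> P" "(a \<otimes> b) [^] n = c \<otimes> b [^] n" using Suc by blast
  have "(a \<otimes> b) [^] Suc n = (c \<otimes> conjby (b [^] n) a) \<otimes> b [^] Suc n"
    using c assms by (simp add: conjby_def m_assoc)
  moreover have "c \<otimes> conjby (b [^] n) a \<in> P"
    using c(1) assms by (simp add: normal_conjby)
  ultimately show ?case by blast
qed

text \<open>Modulo \<open>P\<close>, the element a b equals \<open>b\<close>, so some
  \<open>p\<close>-power of it lies in \<open>P\<close> (this is
  \<open>mult_pow_in_normal_coset\<close>), and a further \<open>p\<close>-power makes it
  trivial.\<close>

lemma normal_set_mult_p_torsion:
  assumes P: "P \<lhd> G" "p_torsion G p P" and Q: "Q \<lhd> G" "p_torsion G p Q"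
  shows "P <#> Q \<lhd> G" "p_torsion G p (P <#> Q)"
proof -
  interpret P: normal P G by (rule P(1))
  interpret Q: normal Q G by (rule Q(1))
  have "subgroup (P <#> Q) G"
    by (rule second_isomorphism_grp.normal_set_mult_subgroup)
       (simp add: second_isomorphism_grp_def second_isomorphism_grp_axioms_def P Q.subgroup_axioms)
  moreover have "conjby g n \<in> P <#> Q" if g: "g \<in> carrier G" and n: "n \<in> P <#> Q" for g n
  proof -
    obtain a b where ab: "a \<in> P" "b \<in> Q" "n = a \<otimes> b" using n by (auto simp: set_mult_def)
    then have "conjby g n = conjby g a \<otimes> conjby g b" using g by (simp add: conjby_mult)
    moreover have "conjby g a \<in> P" "conjby g b \<in> Q" using ab g P Q normal_conjby by blast+
    ultimately show ?thesis by (auto simp: set_mult_def)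
  qed
  ultimately show "P <#> Q \<lhd> G" by (rule normalI_conjby)
  show "p_torsion G p (P <#> Q)"
    unfolding p_torsion_def
  proof
    fix x assume "x \<in> P <#> Q"
    then obtain a b where ab: "a \<in> P" "b \<in> Q" "x = a \<otimes> b" by (auto simp: set_mult_def)
    obtain k where k: "b [^] (p ^ k) = \<one>" using Q(2) ab(2) by (auto simp: p_torsion_def)
    obtain c where c: "c \<in> P" "x [^] (p ^ k) = c"
      using mult_pow_in_normal_coset[OF P(1) ab(1), of b "p ^ k"] ab k by auto
    obtain l where "c [^] (p ^ l) = \<one>" using P(2) c(1) by (auto simp: p_torsion_def)
    moreover have "x \<in> carrier G" using ab by simp
    ultimately have "x [^] (p ^ (k + l)) = \<one>"
      using c(2) nat_pow_pow[of x "p ^ k" "p ^ l"] by (simp add: power_add)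
    then show "\<exists>k. x [^] (p ^ k) = \<one>" ..
  qed
qed

lemma p_core_p_torsion: "p_torsion G p (p_core G p)"
  by (auto simp: p_core_def p_torsion_def)

lemma p_core_subset: "p_core G p \<subseteq> carrier G"
  using normal_imp_subgroup subgroup.subset by (fastforce simp: p_core_def)

lemma p_core_normal: "p_core G p \<lhd> G"
proof (rule normalI_conjby)
  show "subgroup (p_core G p) G"
  proof (rule subgroupI)
    have "{\<one>} \<lhd> G" "p_torsion G p {\<one>}" by (simp_all add: one_is_normal p_torsion_def)
    then show "p_core G p \<noteq> {}" by (auto simp: p_core_def)
  next
    fix a assume "a \<in> p_core G p"
    then obtain P where P: "P \<lhd> G" "p_torsion G p P" "a \<in> P" by (auto simp: p_core_def)
    have "inv a \<in> P" by (rule subgroup.m_inv_closed[OF normal_imp_subgroup[OF P(1)] P(3)])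
    then show "inv a \<in> p_core G p" using P(1,2) unfolding p_core_def by blast
  next
    fix a b assume "a \<in> p_core G p" "b \<in> p_core G p"
    then obtain P Q where P: "P \<lhd> G" "p_torsion G p P" "a \<in> P" and Q: "Q \<lhd> G" "p_torsion G p Q" "b \<in> Q"
      by (auto simp: p_core_def)
    have "a \<otimes> b \<in> P <#> Q" using P Q by (auto simp: set_mult_def)
    then show "a \<otimes> b \<in> p_core G p"
      using normal_set_mult_p_torsion[OF P(1,2) Q(1,2)] unfolding p_core_def by blast
  qed (rule p_core_subset)
  fix g n assume g: "g \<in> carrier G" and "n \<in> p_core G p"
  then obtain P where "P \<lhd> G" "p_torsion G p P" "n \<in> P" by (auto simp: p_core_def)
  then show "conjby g n \<in> p_core G p" using normal_conjby[OF _ g] unfolding p_core_def by blast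
qed

lemma p_core_of_normal_subset:
  assumes H: "H \<lhd> G"
  shows "p_core (G\<lparr>carrier := H\<rparr>) p \<subseteq> p_core G p"
proof -
  let ?H = "G\<lparr>carrier := H\<rparr>"
  have HG: "subgroup H G" by (rule normal_imp_subgroup[OF H])
  interpret H: group ?H by (rule subgroup_imp_group[OF HG])
  let ?O = "p_core ?H p"
  have O: "subgroup ?O G" "?O \<subseteq> H"
    using restrict_normalD[OF HG H.p_core_normal] by auto
  have "conjby g n \<in> ?O" if g: "g \<in> carrier G" and n: "n \<in> ?O" for g n
  proof -
    obtain P where P: "P \<lhd> ?H" "p_torsion G p P" "n \<in> P" using n by (auto simp: p_core_def)
    note P' = restrict_normalD[OF HG P(1)]
    have PG: "P \<subseteq> carrier G" "H \<subseteq> carrier G" using P'(1) HG by (simp_all add: subgroup.subset)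
    have "conjby g ` P \<lhd> ?H"
    proof (rule restrict_normalI[OF HG])
      show "subgroup (conjby g ` P) G" using g P'(1) by (rule subgroup_conjby_image)
      show "conjby g ` P \<subseteq> H" using P'(2) normal_conjby[OF H g] by blast
      fix h k assume h: "h \<in> H" and "k \<in> conjby g ` P"
      then obtain y where y: "y \<in> P" "k = conjby g y" by blast
      have hG: "h \<in> carrier G" "y \<in> carrier G" using h y PG by auto
      have "conjby (conjby (inv g) h) y \<in> P" using P'(3) y(1) normal_conjby[OF H _ h] g by simp
      moreover have "conjby h k = conjby g (conjby (conjby (inv g) h) y)"
        using y(2) hG g by (simp add: conjby_def m_assoc inv_mult_group)
      ultimately show "conjby h k \<in> conjby g ` P" by blast
    qed
    moreover have "p_torsion G p (conjby g ` P)"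
      unfolding p_torsion_def
    proof
      fix y assume "y \<in> conjby g ` P"
      then obtain z where z: "z \<in> P" "y = conjby g z" by blast
      then obtain k where "z [^] (p ^ k) = \<one>" using P(2) by (auto simp: p_torsion_def)
      moreover have "conjby g (z [^] (p ^ k)) = y [^] (p ^ k)"
        using z g PG by (simp add: conjby_pow subsetD)
      ultimately have "y [^] (p ^ k) = \<one>" using g by (simp add: conjby_def)
      then show "\<exists>k. y [^] (p ^ k) = \<one>" ..
    qed
    ultimately show ?thesis using P(3) by (auto simp: p_core_def)
  qed
  then have "?O \<lhd> G" using O(1) by (intro normalI_conjby)
  moreover have "p_torsion G p ?O" using H.p_core_p_torsion by simp
  ultimately show ?thesis by (auto simp: p_core_def)
qed

lemma subnormal_subgroup: "subnormal G H \<Longrightarrow> subgroup H G"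
  by (induction rule: subnormal.induct) (use subgroup_self restrict_normalD(1) in blast)+

lemma normal_subnormal: "H \<lhd> G \<Longrightarrow> subnormal G H"
  by (rule subnormal.step[OF subnormal.whole]) simp

lemma p_core_of_subnormal_subset:
  "subnormal G H \<Longrightarrow> p_core (G\<lparr>carrier := H\<rparr>) p \<subseteq> p_core G p"
proof (induction rule: subnormal.induct)
  case (step K H)
  have "group (G\<lparr>carrier := K\<rparr>)" using step.hyps(1) subgroup_imp_group subnormal_subgroup by blast
  from group.p_core_of_normal_subset[OF this step.hyps(2), of p] step.IH show ?case by simp
qed simp

lemma subnormal_p_torsion_subset_p_core:
  assumes "subnormal G H" "p_torsion G p H"
  shows "H \<subseteq> p_core G p"
proof -
  have "H \<lhd> G\<lparr>carrier := H\<rparr>"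
    using group.normal_self[OF subgroup_imp_group[OF subnormal_subgroup[OF assms(1)]]] by simp
  then have "H \<subseteq> p_core (G\<lparr>carrier := H\<rparr>) p" using assms(2) by (auto simp: p_core_def)
  then show ?thesis using p_core_of_subnormal_subset[OF assms(1)] by blast
qed

lemma p_core_subset_fitting:
  assumes "finite (carrier G)" "prime p"
  shows "p_core G p \<subseteq> fitting G"
proof -
  let ?P = "G\<lparr>carrier := p_core G p\<rparr>"
  interpret P: group ?P
    by (rule subgroup_imp_group[OF normal_imp_subgroup[OF p_core_normal]])
  have "finite (carrier ?P)" using finite_subset[OF p_core_subset assms(1)] by simp
  then obtain a where "order ?P = p ^ a"
    using P.p_torsion_order[OF _ assms(2)] p_core_p_torsion[of p] by auto
  then have "nilpotent_group ?P" by (rule P.p_group_nilpotent[OF assms(2)])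
  then show ?thesis
    using p_core_normal[of p] unfolding fitting_def by (blast intro: generate.incl)
qed

end

section \<open>The generalized Fitting subgroup\<close>

lemma iso_quasisimple:
  assumes H: "group H" and K: "group K" and f: "f \<in> iso H K" and qs: "quasisimple H"
  shows "quasisimple K"
proof -
  interpret H: group H by (rule H)
  interpret K: group K by (rule K)
  interpret f: group_hom H K f
    using f by (simp add: group_hom_def group_hom_axioms_def H K iso_def)
  have surj: "f ` carrier H = carrier K" and inj: "inj_on f (carrier H)"
    using f by (auto simp: iso_def bij_betw_def)
  have perfect: "derived K (carrier K) = carrier K"
    using f.derived_img[of "carrier H"] qs surj by (simp add: quasisimple_def)
  interpret Z: normal "center K" K by (rule K.center_normal)
  define h where "h = (\<lambda>a. center K #>\<^bsub>K\<^esub> f a)"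
  have "h \<in> hom H (K Mod center K)"
    using hom_compose[OF f.homh Z.r_coset_hom_Mod] by (simp add: h_def comp_def)
  then interpret h: group_hom H "K Mod center K" h
    by (simp add: group_hom_def group_hom_axioms_def H Z.factorgroup_is_group)
  have "h ` carrier H = (\<lambda>x. center K #>\<^bsub>K\<^esub> x) ` f ` carrier H"
    by (simp add: h_def image_image)
  then have "h ` carrier H = carrier (K Mod center K)"
    by (simp add: surj carrier_FactGroup)
  note iso = h.FactGroup_iso_set[OF this]
  have "f a \<in> center K \<longleftrightarrow> a \<in> center H" if a: "a \<in> carrier H" for a
  proof -
    have "f a \<in> center K \<longleftrightarrow> (\<forall>g\<in>carrier H. f a \<otimes>\<^bsub>K\<^esub> f g = f g \<otimes>\<^bsub>K\<^esub> f a)"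
      unfolding center_def surj[symmetric] using a by blast
    also have "\<dots> \<longleftrightarrow> (\<forall>g\<in>carrier H. f (a \<otimes>\<^bsub>H\<^esub> g) = f (g \<otimes>\<^bsub>H\<^esub> a))"
      using a by simp
    also have "\<dots> \<longleftrightarrow> (\<forall>g\<in>carrier H. a \<otimes>\<^bsub>H\<^esub> g = g \<otimes>\<^bsub>H\<^esub> a)"
      using a by (intro ball_cong refl inj_on_eq_iff[OF inj] H.m_closed)
    also have "\<dots> \<longleftrightarrow> a \<in> center H" using a unfolding center_def by blast
    finally show ?thesis .
  qed
  moreover have "center H \<subseteq> carrier H" by (auto simp: center_def)
  moreover have "x \<in> kernel H (K Mod center K) h \<longleftrightarrow> x \<in> carrier H \<and> f x \<in> center K" for x
    by (cases "x \<in> carrier H") (simp_all add: kernel_def h_def Z.rcos_eq_self_iff)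
  ultimately have "kernel H (K Mod center K) h = center H" by blast
  then have "simple_group (K Mod center K)"
    using iso qs simple_group.iso_simple[OF _ Z.factorgroup_is_group]
    by (auto simp: quasisimple_def)
  then show ?thesis by (simp add: quasisimple_def K perfect)
qed

context group
begin

lemma quasisimpleI:
  assumes fin: "finite (carrier G)" and perfect: "derived G (carrier G) = carrier G"
    and nontriv: "carrier G \<noteq> {\<one>}"
    and central: "\<And>N. N \<lhd> G \<Longrightarrow> N \<noteq> carrier G \<Longrightarrow> N \<subseteq> center G"
  shows "quasisimple G"
proof -
  interpret Z: normal "center G" G by (rule center_normal)
  let ?Q = "G Mod center G"
  interpret h: group_hom G ?Q "\<lambda>a. center G #> a" by (rule Z.Mod_group_hom)
  have "center G \<noteq> carrier G"
  proof
    assume eq: "center G = carrier G"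
    then have "x \<otimes> y = y \<otimes> x" if "x \<in> carrier G" "y \<in> carrier G" for x y
      using that unfolding center_def by blast
    then have "comm_group G" by (rule group_comm_groupI)
    then have "derived G (carrier G) = {\<one>}" by (simp add: comm_group.derived_eq_singleton)
    then show False using perfect nontriv by simp
  qed
  then have "order ?Q \<noteq> 1"
    using lagrange[OF center_subgroup] card_subset_eq[OF fin Z.subset]
    unfolding order_def FactGroup_def by force
  moreover have "order ?Q > 0"
    using fin one_closed unfolding order_def carrier_FactGroup card_gt_0_iff by blast
  ultimately have "order ?Q > 1" by linarith
  moreover have "M = carrier ?Q \<or> M = {\<one>\<^bsub>?Q\<^esub>}" if M: "M \<lhd> ?Q" for M
  proof -
    define N where "N = {g \<in> carrier G. center G #> g \<in> M}"
    have N: "N \<lhd> G" unfolding N_def by (rule h.normal_preimage[OF M])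
    have M': "subgroup M ?Q" by (rule normal_imp_subgroup[OF M])
    have MN: "M = (\<lambda>a. center G #> a) ` N"
      using subgroup.subset[OF M'] by (auto simp: N_def carrier_FactGroup)
    show ?thesis
    proof (cases "N = carrier G")
      case True
      then show ?thesis using MN by (simp add: carrier_FactGroup)
    next
      case False
      then have "N \<subseteq> center G" using central N by blast
      then have "M \<subseteq> {center G}"
        using MN Z.rcos_eq_self_iff Z.subset by auto
      then show ?thesis using subgroup.one_closed[OF M'] by auto
    qed
  qed
  ultimately have "simple_group ?Q"
    by (simp add: simple_group_def simple_group_axioms_def Z.factorgroup_is_group)
  then show ?thesis by (simp add: quasisimple_def perfect)
qed

lemma subnormal_conjby:
  assumes "subnormal G H" "g \<in> carrier G"
  shows "subnormal G (conjby g ` H)"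
  using assms(1)
proof (induction rule: subnormal.induct)
  case whole
  have "conjby g ` carrier G = carrier G"
    by (rule conjby_image_normal[OF normal_self assms(2)])
  then show ?case using subnormal.whole[of G] by simp
next
  case (step K H)
  have K: "subgroup K G" by (rule subnormal_subgroup[OF step.hyps(1)])
  note H = restrict_normalD[OF K step.hyps(2)]
  have "conjby g ` H \<lhd> G\<lparr>carrier := conjby g ` K\<rparr>"
  proof (rule restrict_normalI)
    fix y z assume "y \<in> conjby g ` K" "z \<in> conjby g ` H"
    then obtain k h where kh: "k \<in> K" "h \<in> H" "y = conjby g k" "z = conjby g h" by blast
    have "k \<in> carrier G" "h \<in> carrier G"
      using kh subgroup.mem_carrier[OF K] subgroup.mem_carrier[OF H(1)] by blast+
    then have "conjby y z = conjby g (conjby k h)"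
      using kh assms(2) by (simp add: conjby_def m_assoc inv_mult_group)
    then show "conjby y z \<in> conjby g ` H" using H(3) kh by blast
  qed (use K H assms subgroup_conjby_image in blast)+
  with step.IH show ?case by (rule subnormal.step)
qed

lemma component_conjby:
  assumes L: "component G L" and g: "g \<in> carrier G"
  shows "component G (conjby g ` L)"
proof -
  have sub: "subgroup L G" using L subnormal_subgroup by (simp add: component_def)
  have LG: "L \<subseteq> carrier G" by (rule subgroup.subset[OF sub])
  have "conjby g \<in> iso (G\<lparr>carrier := L\<rparr>) (G\<lparr>carrier := conjby g ` L\<rparr>)"
    using LG g conjby_inj_on[OF g LG]
    by (auto simp: iso_def hom_def bij_betw_def conjby_mult subset_iff)
  moreover have "quasisimple (G\<lparr>carrier := L\<rparr>)" using L by (simp add: component_def)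
  ultimately have "quasisimple (G\<lparr>carrier := conjby g ` L\<rparr>)"
    by (intro iso_quasisimple[OF subgroup_imp_group[OF sub]
          subgroup_imp_group[OF subgroup_conjby_image[OF g sub]]])
  moreover have "subnormal G (conjby g ` L)"
    using L g by (intro subnormal_conjby) (simp_all add: component_def)
  ultimately show ?thesis by (simp add: component_def)
qed

lemma fitting_normal: "fitting G \<lhd> G"
  unfolding fitting_def
proof (rule normal_generateI)
  show "\<Union> {N. N \<lhd> G \<and> nilpotent_group (G\<lparr>carrier := N\<rparr>)} \<subseteq> carrier G"
    by (intro Union_least subgroup.subset normal_imp_subgroup) simp
  fix h g assume "h \<in> \<Union> {N. N \<lhd> G \<and> nilpotent_group (G\<lparr>carrier := N\<rparr>)}" and g: "g \<in> carrier G"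
  then obtain N where N: "N \<lhd> G" "nilpotent_group (G\<lparr>carrier := N\<rparr>)" "h \<in> N" by blast
  have "g \<otimes> h \<otimes> inv g \<in> N" by (rule normal.inv_op_closed2[OF N(1) g N(3)])
  then show "g \<otimes> h \<otimes> inv g \<in> \<Union> {N. N \<lhd> G \<and> nilpotent_group (G\<lparr>carrier := N\<rparr>)}"
    using N(1,2) by blast
qed

lemma fitting_subset: "fitting G \<subseteq> carrier G"
  by (rule subgroup.subset[OF normal_imp_subgroup[OF fitting_normal]])

lemma component_subset: "component G L \<Longrightarrow> L \<subseteq> carrier G"
  by (rule subgroup.subset[OF subnormal_subgroup]) (simp add: component_def)

lemma generalized_fitting_normal: "generalized_fitting G \<lhd> G"
  unfolding generalized_fitting_def
proof (rule normal_generateI)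
  show "fitting G \<union> \<Union> {L. component G L} \<subseteq> carrier G"
  proof (intro Un_least Union_least)
    show "L \<subseteq> carrier G" if "L \<in> {L. component G L}" for L
      by (rule component_subset) (use that in simp)
  qed (rule fitting_subset)
  fix h g assume h: "h \<in> fitting G \<union> \<Union> {L. component G L}" and g: "g \<in> carrier G"
  from h show "g \<otimes> h \<otimes> inv g \<in> fitting G \<union> \<Union> {L. component G L}"
  proof
    assume "h \<in> fitting G"
    then have "conjby g h \<in> fitting G" by (rule normal_conjby[OF fitting_normal g])
    then show ?thesis by (simp add: conjby_def)
  next
    assume "h \<in> \<Union> {L. component G L}"
    then obtain L where L: "component G L" "h \<in> L" by blast
    have "conjby g h \<in> conjby g ` L" using L(2) by (rule imageI)
    then show ?thesis using component_conjby[OF L(1) g] by (auto simp: conjby_def)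
  qed
qed

lemma fitting_subset_generalized_fitting: "fitting G \<subseteq> generalized_fitting G"
  unfolding generalized_fitting_def by (blast intro: generate.incl)

lemma component_subset_generalized_fitting: "component G L \<Longrightarrow> L \<subseteq> generalized_fitting G"
  unfolding generalized_fitting_def by (blast intro: generate.incl)

end

section \<open>Bender's theorem\<close>

context group
begin

definition set_centralizer :: "'a set \<Rightarrow> 'a set" where
  "set_centralizer A = {g \<in> carrier G. \<forall>a\<in>A. conjby g a = a}"

lemma set_centralizer_normal:
  assumes N: "N \<lhd> G"
  shows "set_centralizer N \<lhd> G"
proof (rule normalI_conjby)
  have NG: "n \<in> carrier G" if "n \<in> N" for n
    using subgroup.mem_carrier[OF normal_imp_subgroup[OF N] that] .
  show "subgroup (set_centralizer N) G"
  proof (rule subgroupI)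
    have "\<one> \<in> set_centralizer N" using NG by (simp add: set_centralizer_def)
    then show "set_centralizer N \<noteq> {}" by blast
  next
    fix a assume a: "a \<in> set_centralizer N"
    then have aG: "a \<in> carrier G" by (simp add: set_centralizer_def)
    have "conjby (inv a) n = n" if n: "n \<in> N" for n
    proof -
      have "conjby (inv a) (conjby a n) = n" using aG NG[OF n] by simp
      moreover have "conjby a n = n" using a n by (simp add: set_centralizer_def)
      ultimately show ?thesis by simp
    qed
    then show "inv a \<in> set_centralizer N" using aG by (simp add: set_centralizer_def)
  next
    fix a b assume ab: "a \<in> set_centralizer N" "b \<in> set_centralizer N"
    then show "a \<otimes> b \<in> set_centralizer N"
      using NG by (simp add: set_centralizer_def flip: conjby_conjby)
  qed (auto simp: set_centralizer_def)
  fix g c assume g: "g \<in> carrier G" and "c \<in> set_centralizer N"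
  then have c: "c \<in> carrier G" "\<And>n. n \<in> N \<Longrightarrow> conjby c n = n" by (simp_all add: set_centralizer_def)
  have "conjby (conjby g c) n = n" if n: "n \<in> N" for n
  proof -
    have "conjby (conjby g c) n = conjby g (conjby c (conjby (inv g) n))"
      using g c(1) NG[OF n] by (simp add: conjby_def m_assoc inv_mult_group)
    also have "conjby c (conjby (inv g) n) = conjby (inv g) n"
      using g n by (intro c(2) normal_conjby[OF N]) auto
    finally show ?thesis using g NG[OF n] by simp
  qed
  then show "conjby g c \<in> set_centralizer N" using g c(1) by (simp add: set_centralizer_def)
qed

lemma normal_if_derived_subset:
  assumes K: "subgroup K G" "derived G (carrier G) \<subseteq> K"
  shows "K \<lhd> G"
proof (rule normalI_conjby[OF K(1)])
  fix g k assume g: "g \<in> carrier G" and k: "k \<in> K"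
  have kG: "k \<in> carrier G" using subgroup.mem_carrier[OF K(1) k] .
  have "g \<otimes> k \<otimes> inv g \<otimes> inv k \<in> derived G (carrier G)"
    unfolding derived_def using g kG by (blast intro: generate.incl)
  then have "(g \<otimes> k \<otimes> inv g \<otimes> inv k) \<otimes> k \<in> K"
    using K(2) by (intro subgroup.m_closed[OF K(1) _ k]) (rule subsetD)
  then show "conjby g k \<in> K" using g kG by (simp add: conjby_def m_assoc)
qed

lemma central_insert_generates_central:
  assumes D: "D \<subseteq> center G" and h: "h \<in> carrier G" and gen: "generate G (insert h D) = carrier G"
  shows "h \<in> center G"
proof -
  have DG: "D \<subseteq> carrier G" using D by (auto simp: center_def)
  have "conjby g h = h" if "g \<in> generate G (insert h D)" for g
    using that
  proof (induction rule: generate.induct)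
    case one
    then show ?case using h by simp
  next
    case (incl g)
    then show ?case
    proof
      assume "g \<in> D"
      then have "g \<in> carrier G" "h \<otimes> g = g \<otimes> h" using D h by (auto simp: center_def)
      then show ?thesis using h by (simp add: conjby_eq_iff_commute)
    qed (use h in \<open>simp add: conjby_eq_iff_commute\<close>)
  next
    case (inv g)
    then have gG: "g \<in> carrier G" using h DG by blast
    have "conjby g h = h"
      using inv
    proof
      assume "g \<in> D"
      then have "g \<in> carrier G" "h \<otimes> g = g \<otimes> h" using D h by (auto simp: center_def)
      then show ?thesis using h by (simp add: conjby_eq_iff_commute)
    qed (use h in \<open>simp add: conjby_eq_iff_commute\<close>)
    then show ?case using conjby_inv_cancel(1)[OF gG h] by simp
  next
    case (eng g1 g2)
    then have "g1 \<in> carrier G" "g2 \<in> carrier G" using gen by auto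
    then show ?case using eng h by (simp flip: conjby_conjby)
  qed
  then show ?thesis using h gen by (simp add: center_iff)
qed

lemma minimal_order_outside_subgroup:
  assumes fin: "finite (carrier G)" and F: "subgroup F G" and h: "h \<in> carrier G" "h \<notin> F"
    and min: "\<And>g. g \<in> generate G {h} \<Longrightarrow> g \<notin> F \<Longrightarrow> ord h \<le> ord g"
  obtains p a where "prime p" "ord h = p ^ a"
proof -
  have n0: "ord h > 0" using ord_ge_1[OF fin h(1)] by simp
  have "ord h \<noteq> 1" using h subgroup.one_closed[OF F] ord_eq_1 by blast
  then obtain p where p: "prime p" "p dvd ord h" using prime_factor_nat by blast
  obtain m where m: "ord h = p ^ multiplicity p (ord h) * m" "\<not> p dvd m"
    using multiplicity_decompose'[of "ord h" p] n0 p(1) by (metis not_prime_unit gr_implies_not0)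
  define a where "a = multiplicity p (ord h)"
  note m = m[folded a_def]
  have "a > 0" unfolding a_def using p n0 by (simp add: prime_multiplicity_gt_zero_iff)
  then have pa: "p ^ a > 1" using prime_gt_1_nat[OF p(1)] by (intro one_less_power)
  have "m = 1"
  proof (rule ccontr)
    assume "m \<noteq> 1"
    moreover have "m \<noteq> 0"
    proof
      assume "m = 0"
      then show False using m(1) n0 by simp
    qed
    ultimately have m1: "m > 1" by linarith
    have inF: "h [^] d \<in> F" if d: "d dvd ord h" "d > 1" for d :: nat
    proof (rule ccontr)
      assume "h [^] d \<notin> F"
      moreover have "h [^] d \<in> generate G {h}"
        using generate_pow_on_finite_carrier[OF fin h(1)] by blast
      ultimately have "ord h \<le> ord (h [^] d)" using min by blast
      also have "ord (h [^] d) = ord h div d" using d h(1) by (intro ord_pow) auto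
      also have "\<dots> < ord h" using d n0 by simp
      finally show False by simp
    qed
    have "p ^ a dvd ord h" "m dvd ord h" unfolding m(1) by simp_all
    then have F1: "h [^] (p ^ a) \<in> F" "h [^] m \<in> F" using inF pa m1 by blast+
    have cop: "gcd (p ^ a) m = 1" using p(1) m(2) by (simp add: prime_imp_coprime)
    obtain u v where uv: "p ^ a * u = m * v + 1"
      using bezout_nat[of "p ^ a" m] pa cop by (metis not_one_less_zero)
    have Fpow: "y [^] (k::nat) \<in> F" if "y \<in> F" for y k
      using that subgroup.m_closed[OF F] subgroup.one_closed[OF F] by (induction k) auto
    have "h [^] (p ^ a * u) = h [^] (m * v) \<otimes> h" by (simp only: uv) (simp add: h)
    then have "h = inv ((h [^] m) [^] v) \<otimes> (h [^] (p ^ a)) [^] u"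
      using h by (simp add: nat_pow_pow)
    also have "\<dots> \<in> F"
      using F1 Fpow subgroup.m_closed[OF F] subgroup.m_inv_closed[OF F] by blast
    finally show False using h by blast
  qed
  then show thesis using that p(1) m(1) by simp
qed

text \<open>In a subnormal subgroup that is minimal among those centralizing \<open>F\<^sup>*\<close>
  without being contained in it, every proper normal subgroup is central; hence it is a component or
  abelian, and in the abelian case it contains a subnormal \<open>p\<close>-subgroup outside \<open>F\<^sup>*\<close>.\<close>
theorem set_centralizer_generalized_fitting_subset:
  assumes fin: "finite (carrier G)"
  shows "set_centralizer (generalized_fitting G) \<subseteq> generalized_fitting G"
proof (rule ccontr)
  define F where "F = generalized_fitting G"
  assume "\<not> set_centralizer (generalized_fitting G) \<subseteq> generalized_fitting G"
  then have CF: "\<not> set_centralizer F \<subseteq> F" by (simp add: F_def)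
  have F: "F \<lhd> G" unfolding F_def by (rule generalized_fitting_normal)
  have Fs: "subgroup F G" by (rule normal_imp_subgroup[OF F])
  define good where "good H \<longleftrightarrow> subnormal G H \<and> H \<subseteq> set_centralizer F \<and> \<not> H \<subseteq> F" for H
  have "good (set_centralizer F)"
    using CF by (simp add: good_def normal_subnormal set_centralizer_normal F)
  then obtain H where H: "good H" and min: "\<And>K. good K \<Longrightarrow> card H \<le> card K"
    using ex_has_least_nat[of good _ card] by blast
  have Hsub: "subnormal G H" "H \<subseteq> set_centralizer F" "\<not> H \<subseteq> F" using H by (simp_all add: good_def)
  have HG: "subgroup H G" by (rule subnormal_subgroup[OF Hsub(1)])
  have HC: "H \<subseteq> carrier G" by (rule subgroup.subset[OF HG])
  have finH: "finite H" using HC fin finite_subset by blast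
  let ?H = "G\<lparr>carrier := H\<rparr>"
  interpret H: group ?H by (rule subgroup_imp_group[OF HG])
  have conjF: "conjby h k = k" if "h \<in> H" "k \<in> F" for h k
    using that Hsub(2) by (auto simp: set_centralizer_def)
  have normal_in_F: "K \<subseteq> F" if K: "K \<lhd> ?H" "K \<noteq> H" for K
  proof (rule ccontr)
    assume "\<not> K \<subseteq> F"
    moreover have KH: "K \<subseteq> H" using restrict_normalD(2)[OF HG K(1)] .
    ultimately have "good K"
      using Hsub(2) subnormal.step[OF Hsub(1) K(1)] by (auto simp: good_def)
    then have "card H \<le> card K" by (rule min)
    then show False using card_seteq[OF finH KH] K(2) by blast
  qed
  have central: "k \<in> center ?H" if "k \<in> H" "k \<in> F" for k
    using that conjF by (simp add: H.center_iff conjby_consistent[OF HG])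
  have normal_central: "K \<subseteq> center ?H" if K: "K \<lhd> ?H" "K \<noteq> H" for K
    using normal_in_F[OF K] restrict_normalD(2)[OF HG K(1)] central by blast
  let ?D = "derived ?H H"
  have D: "?D \<lhd> ?H" using H.derived_is_normal[OF H.normal_self] by simp
  show False
  proof (cases "?D = H")
    case True
    have "H \<noteq> {\<one>}" using Hsub(3) subgroup.one_closed[OF Fs] by blast
    then have "quasisimple ?H"
      using finH True normal_central by (intro H.quasisimpleI) auto
    then have "component G H" using Hsub(1) by (simp add: component_def)
    then have "H \<subseteq> F" unfolding F_def by (rule component_subset_generalized_fitting)
    then show False using Hsub(3) by blast
  next
    case False
    have DZ: "?D \<subseteq> center ?H" by (rule normal_central[OF D False])
    have DH: "?D \<subseteq> H" using restrict_normalD(2)[OF HG D] .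
    have central': "h \<in> center ?H" if h: "h \<in> H" for h
    proof (cases "h \<in> F")
      case True
      then show ?thesis using central h by blast
    next
      case hF: False
      let ?K = "generate ?H (insert h ?D)"
      have K: "subgroup ?K ?H" using h DH by (intro H.generate_is_subgroup) auto
      have "?D \<subseteq> ?K" by (auto intro: generate.incl)
      then have "?K \<lhd> ?H" using H.normal_if_derived_subset[OF K] by simp
      moreover have "h \<in> ?K" by (simp add: generate.incl)
      ultimately have "?K = H" using normal_in_F hF by blast
      then show ?thesis using H.central_insert_generates_central[OF DZ] h by simp
    qed
    obtain h0 where "h0 \<in> H \<and> h0 \<notin> F" using Hsub(3) by blast
    then obtain h where h: "h \<in> H" "h \<notin> F" and hmin: "\<And>g. g \<in> H \<Longrightarrow> g \<notin> F \<Longrightarrow> ord h \<le> ord g"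
      using ex_has_least_nat[of "\<lambda>g. g \<in> H \<and> g \<notin> F" h0 ord] by blast
    have hG: "h \<in> carrier G" using h HC by blast
    have gen: "generate G {h} \<subseteq> H" using h by (intro generate_subgroup_incl HG) simp
    then obtain p a where p: "prime p" "ord h = p ^ a"
      using minimal_order_outside_subgroup[OF fin Fs hG h(2)] hmin by blast
    have "generate G {h} \<lhd> ?H"
    proof (rule H.subgroup_of_center_normal)
      show "subgroup (generate G {h}) ?H"
        using gen hG by (simp add: subgroup_restrict_iff[OF HG] generate_is_subgroup)
    qed (use gen central' in blast)
    then have sub: "subnormal G (generate G {h})" by (rule subnormal.step[OF Hsub(1)])
    have "p_torsion G p (generate G {h})"
      unfolding p_torsion_def
    proof
      fix g assume "g \<in> generate G {h}"
      then obtain k :: nat where k: "g = h [^] k" using generate_pow_on_finite_carrier[OF fin hG] by blast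
      have "g [^] (p ^ a) = (h [^] (p ^ a)) [^] k" using hG k by (simp add: nat_pow_pow mult.commute)
      then have "g [^] (p ^ a) = \<one>" using hG pow_ord_eq_1[OF hG] p(2) by simp
      then show "\<exists>k. g [^] (p ^ k) = \<one>" ..
    qed
    then have "generate G {h} \<subseteq> p_core G p" by (rule subnormal_p_torsion_subset_p_core[OF sub])
    also have "\<dots> \<subseteq> F"
      unfolding F_def using p_core_subset_fitting[OF fin p(1)] fitting_subset_generalized_fitting by blast
    finally show False using h(2) generate.incl[of h "{h}" G] by blast
  qed
qed

end

section \<open>Conjugates under an invariant subgroup of prime power order\<close>

context group
begin

lemma conjby_eq_self_sym:
  "g \<in> carrier G \<Longrightarrow> t \<in> carrier G \<Longrightarrow> conjby g t = t \<longleftrightarrow> conjby t g = g"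
  using conjby_eq_iff_commute[of g t] conjby_eq_iff_commute[of t g] by argo

lemma ord_conjby: "g \<in> carrier G \<Longrightarrow> t \<in> carrier G \<Longrightarrow> ord (conjby g t) = ord t"
proof -
  assume g: "g \<in> carrier G" and t: "t \<in> carrier G"
  have "conjby g t [^] n = \<one> \<longleftrightarrow> t [^] n = \<one>" for n :: nat
  proof -
    have "conjby g t [^] n = conjby g (t [^] n)" using g t by (simp add: conjby_pow)
    moreover have "conjby g \<one> = \<one>" using g by (simp add: conjby_def)
    moreover have "inj_on (conjby g) (carrier G)" using conjby_bij[OF g] by (simp add: bij_betw_def)
    ultimately show ?thesis using inj_on_eq_iff[of "conjby g" "carrier G" "t [^] n" \<one>] t by simp
  qed
  then show ?thesis using g t by (simp add: ord_unique pow_eq_id)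
qed

lemma pow_fixed:
  assumes "g \<in> carrier G" "t \<in> carrier G" "conjby g t = t"
  shows "conjby (g [^] (n::nat)) t = t"
proof (induction n)
  case (Suc n)
  have "conjby (g [^] Suc n) t = conjby (g [^] n) (conjby g t)"
    using assms(1,2) by (simp add: conjby_conjby)
  then show ?case using Suc assms(3) by simp
qed (use assms in simp)

lemma eq_one_if_coprime_pows:
  assumes "e \<in> carrier G" "e [^] (m::nat) = \<one>" "e [^] (n::nat) = \<one>" "coprime m n"
  shows "e = \<one>"
proof -
  have "ord e dvd m" "ord e dvd n" using assms by (simp_all flip: pow_eq_id)
  then have "ord e = 1" using assms(4) coprime_common_divisor_nat by blast
  then show ?thesis using assms(1) ord_eq_1 by blast
qed

end

locale coprime_prime_action = group G for G (structure) +
  fixes x :: 'a and q s k :: nat and S :: "'a set"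
  assumes finite_carrier: "finite (carrier G)"
    and q_prime: "prime q" and s_prime: "prime s" and s_neq_q: "s \<noteq> q"
    and x_in: "x \<in> carrier G" and x_pow: "x [^] q = \<one>"
    and S_subgroup: "subgroup S G" and card_S: "card S = s ^ k" and x_S: "conjby x ` S = S"
begin

definition conjugates :: "'a set" where "conjugates = (\<lambda>n. conjby n x) ` S"

definition commuting_conjugates :: "'a \<Rightarrow> 'a set" where
  "commuting_conjugates u = {X \<in> conjugates. conjby u X = X}"

lemma S_carrier: "n \<in> S \<Longrightarrow> n \<in> carrier G"
  using subgroup.mem_carrier[OF S_subgroup] .

lemma finite_S: "finite S"
  using finite_subset[OF subgroup.subset[OF S_subgroup] finite_carrier] .

lemma conjugates_carrier: "X \<in> conjugates \<Longrightarrow> X \<in> carrier G"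
  using S_carrier x_in by (auto simp: conjugates_def)

lemma x_conjugate: "x \<in> conjugates"
  unfolding conjugates_def using subgroup.one_closed[OF S_subgroup] x_in by force

lemma finite_conjugates: "finite conjugates"
  by (simp add: conjugates_def finite_S)

lemma conjugates_pow:
  assumes "X \<in> conjugates"
  shows "X [^] q = \<one>"
proof -
  obtain n where n: "n \<in> S" "X = conjby n x" using assms by (auto simp: conjugates_def)
  then have "X [^] q = conjby n (x [^] q)" using S_carrier x_in by (simp add: conjby_pow)
  then show ?thesis using x_pow S_carrier[OF n(1)] by (simp add: conjby_def)
qed

lemma coprime_q_s: "coprime q (s ^ n)"
  using primes_coprime[OF q_prime s_prime] s_neq_q by simp

lemma conjugates_normalize_S:
  assumes X: "X \<in> conjugates" and d: "d \<in> S"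
  shows "conjby X d \<in> S"
proof -
  obtain n where n: "n \<in> S" "X = conjby n x" using X by (auto simp: conjugates_def)
  have n': "inv n \<in> S" using n subgroup.m_inv_closed[OF S_subgroup] by blast
  have "conjby X d = conjby n (conjby x (conjby (inv n) d))"
    using n d S_carrier x_in by (simp add: conjby_def m_assoc inv_mult_group)
  moreover have "conjby x (conjby (inv n) d) \<in> S"
    using x_S subgroup_conjby[OF S_subgroup n' d] by blast
  ultimately show ?thesis using subgroup_conjby[OF S_subgroup n(1)] by simp
qed

lemma inv_conjby_S: "d \<in> S \<Longrightarrow> conjby (inv x) d \<in> S"
proof -
  assume "d \<in> S"
  then obtain c where "c \<in> S" "d = conjby x c" using x_S by blast
  then show ?thesis using S_carrier x_in by simp
qed

lemma conjugates_diff: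
  assumes "X \<in> conjugates" "Y \<in> conjugates"
  shows "inv X \<otimes> Y \<in> S"
proof -
  have coset: "inv x \<otimes> conjby n x \<in> S" if n: "n \<in> S" for n
  proof -
    have "inv x \<otimes> conjby n x = conjby (inv x) n \<otimes> inv n"
      using S_carrier[OF n] x_in by (simp add: conjby_def m_assoc)
    then show ?thesis
      using n inv_conjby_S subgroup.m_closed[OF S_subgroup] subgroup.m_inv_closed[OF S_subgroup] by simp
  qed
  have XY: "inv x \<otimes> X \<in> S" "inv x \<otimes> Y \<in> S" using assms coset by (auto simp: conjugates_def)
  have "inv X \<otimes> Y = inv (inv x \<otimes> X) \<otimes> (inv x \<otimes> Y)"
    using assms conjugates_carrier x_in by (simp add: m_assoc inv_mult_group)
  then show ?thesis
    using XY subgroup.m_closed[OF S_subgroup] subgroup.m_inv_closed[OF S_subgroup] by simp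
qed

lemma S_pow: "d \<in> S \<Longrightarrow> d [^] (s ^ k) = \<one>"
  using group.pow_order_eq_1[OF subgroup_imp_group[OF S_subgroup], of d] card_S
  by (simp add: order_def nat_pow_consistent[symmetric])

lemma commuting_conjugates_eq:
  assumes X: "X \<in> conjugates" and Y: "Y \<in> conjugates" and comm: "conjby X Y = Y"
  shows "X = Y"
proof -
  have XY: "X \<in> carrier G" "Y \<in> carrier G" using X Y conjugates_carrier by auto
  have "inv X \<otimes> Y = Y \<otimes> inv X"
  proof -
    have "X \<otimes> Y = Y \<otimes> X" using comm XY by (simp add: conjby_eq_iff_commute)
    then have "inv X \<otimes> (X \<otimes> Y) \<otimes> inv X = inv X \<otimes> (Y \<otimes> X) \<otimes> inv X" by simp
    then show ?thesis using XY by (simp add: m_assoc)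
  qed
  then have "(inv X \<otimes> Y) [^] q = inv X [^] q \<otimes> Y [^] q"
    using XY by (intro pow_mult_distrib) auto
  then have "(inv X \<otimes> Y) [^] q = \<one>"
    using XY conjugates_pow[OF X] conjugates_pow[OF Y] by (simp add: nat_pow_inv)
  moreover have "(inv X \<otimes> Y) [^] (s ^ k) = \<one>" by (rule S_pow[OF conjugates_diff[OF X Y]])
  ultimately have "inv X \<otimes> Y = \<one>"
    using XY eq_one_if_coprime_pows[OF _ _ _ coprime_q_s] by blast
  then show ?thesis using XY by (metis inv_cancel(2) r_one)
qed

lemma prime_power_subgroup_of_S:
  assumes "subgroup D G" "D \<subseteq> S"
  shows "\<exists>i. card D = s ^ i"
proof -
  have "subgroup D (G\<lparr>carrier := S\<rparr>)" using assms by (simp add: subgroup_restrict_iff[OF S_subgroup])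
  then have "card D dvd order (G\<lparr>carrier := S\<rparr>)"
    using group.lagrange[OF subgroup_imp_group[OF S_subgroup]] dvd_triv_right by metis
  then show ?thesis using card_S divides_primepow_nat[OF s_prime] by (auto simp: order_def)
qed

lemma card_conjugates_under_subgroup:
  assumes D: "subgroup D G" "D \<subseteq> S" and X: "X \<in> conjugates"
    and norm: "\<And>d. d \<in> D \<Longrightarrow> conjby X d \<in> D"
    and sub: "(\<lambda>d. conjby d X) ` D \<subseteq> conjugates"
  shows "\<exists>i. card ((\<lambda>d. conjby d X) ` D) = s ^ i" "card ((\<lambda>d. conjby d X) ` D) mod q = 1"
proof -
  define B where "B = (\<lambda>d. conjby d X) ` D"
  let ?D = "G\<lparr>carrier := D\<rparr>"
  interpret D: group ?D by (rule subgroup_imp_group[OF D(1)])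
  have XG: "X \<in> carrier G" by (rule conjugates_carrier[OF X])
  have DG: "d \<in> carrier G" if "d \<in> D" for d using that D(2) S_carrier by blast
  have OG: "Y \<in> carrier G" if "Y \<in> B" for Y using that XG DG by (auto simp: B_def)
  have finO: "finite B" unfolding B_def using D(2) finite_S finite_subset by blast
  have XO: "X \<in> B" unfolding B_def using subgroup.one_closed[OF D(1)] XG by force
  have closed: "conjby d Y \<in> B" if d: "d \<in> D" and Y: "Y \<in> B" for d Y
  proof -
    obtain c where c: "c \<in> D" "Y = conjby c X" using Y by (auto simp: B_def)
    then have "conjby d Y = conjby (d \<otimes> c) X" using d DG XG by (simp add: conjby_conjby)
    then show ?thesis using subgroup.m_closed[OF D(1) d c(1)] by (auto simp: B_def)
  qed
  define \<phi> where "\<phi> = (\<lambda>g. restrict (conjby g) B)"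
  interpret A: group_action ?D B \<phi>
    unfolding \<phi>_def
    by (rule D.group_action_of_fun) (use closed OG DG in \<open>auto simp: conjby_conjby\<close>)
  have "orbit ?D \<phi> X = B"
    using XO by (auto simp: orbit_def \<phi>_def B_def)
  then have "card B * card (stabilizer ?D \<phi> X) = card D"
    using A.orbit_stabilizer_theorem[OF XO] by (simp add: order_def)
  moreover obtain j where "card D = s ^ j" using prime_power_subgroup_of_S[OF D] by blast
  ultimately have "card B dvd s ^ j" by (metis dvd_triv_left)
  then have "\<exists>i. card B = s ^ i" using divides_primepow_nat[OF s_prime] by blast
  then show "\<exists>i. card ((\<lambda>d. conjby d X) ` D) = s ^ i" by (simp add: B_def)
  have "card B mod q = card {Y \<in> B. conjby X Y = Y} mod q"
  proof (rule funpow_prime_fixpoints[OF q_prime finO])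
    fix Y assume Y: "Y \<in> B"
    then obtain c where c: "c \<in> D" "Y = conjby c X" by (auto simp: B_def)
    have "conjby X Y = conjby (conjby X c) X"
      using c DG XG by (simp add: conjby_def m_assoc inv_mult_group)
    then show "conjby X Y \<in> B" using norm[OF c(1)] by (auto simp: B_def)
    show "(conjby X ^^ q) Y = Y"
      using conjby_funpow[OF XG OG[OF Y], of q] conjugates_pow[OF X] OG[OF Y] by simp
  qed
  also have "{Y \<in> B. conjby X Y = Y} = {X}"
  proof -
    have "conjby X X = X" using XG by (simp add: conjby_eq_iff_commute)
    moreover have "B \<subseteq> conjugates" using sub by (simp add: B_def)
    ultimately show ?thesis using XO commuting_conjugates_eq[OF X] by blast
  qed
  finally show "card ((\<lambda>d. conjby d X) ` D) mod q = 1"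
    using prime_gt_1_nat[OF q_prime] by (simp add: B_def)
qed

lemma card_conjugates: "\<exists>i. card conjugates = s ^ i" "card conjugates mod q = 1"
  using card_conjugates_under_subgroup[OF S_subgroup subset_refl x_conjugate]
    conjugates_normalize_S[OF x_conjugate]
  by (auto simp: conjugates_def)

lemma commuting_conjugates_transitive:
  assumes u: "u \<in> carrier G" and X: "X \<in> commuting_conjugates u"
  defines "D \<equiv> {d \<in> S. conjby u d = d}"
  shows "subgroup D G" "(\<lambda>d. conjby d X) ` D = commuting_conjugates u"
proof -
  have XQ: "X \<in> conjugates" and uX: "conjby u X = X"
    using X by (simp_all add: commuting_conjugates_def)
  have XG: "X \<in> carrier G" by (rule conjugates_carrier[OF XQ])
  interpret u: group_hom G G "conjby u" by (rule conjby_group_hom[OF u])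
  have DG: "d \<in> carrier G" if "d \<in> D" for d using that S_carrier by (simp add: D_def)
  show D: "subgroup D G"
  proof (rule subgroupI)
    have "\<one> \<in> D" using subgroup.one_closed[OF S_subgroup] by (simp add: D_def)
    then show "D \<noteq> {}" by blast
  next
    fix d assume "d \<in> D"
    then show "inv d \<in> D"
      using subgroup.m_inv_closed[OF S_subgroup] S_carrier by (simp add: D_def)
  next
    fix d e assume "d \<in> D" "e \<in> D"
    then show "d \<otimes> e \<in> D"
      using subgroup.m_closed[OF S_subgroup] S_carrier by (simp add: D_def)
  qed (use DG in blast)
  show "(\<lambda>d. conjby d X) ` D = commuting_conjugates u"
  proof
    show "(\<lambda>d. conjby d X) ` D \<subseteq> commuting_conjugates u"
    proof
      fix Y assume "Y \<in> (\<lambda>d. conjby d X) ` D"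
      then obtain d where d: "d \<in> D" "Y = conjby d X" by blast
      obtain n where n: "n \<in> S" "X = conjby n x" using XQ by (auto simp: conjugates_def)
      have "Y = conjby (d \<otimes> n) x" using d n DG S_carrier x_in by (simp add: conjby_conjby)
      moreover have "d \<otimes> n \<in> S" using d n subgroup.m_closed[OF S_subgroup] by (simp add: D_def)
      ultimately have "Y \<in> conjugates" by (simp add: conjugates_def)
      moreover have "conjby u Y = Y"
        using d u uX DG[OF d(1)] XG by (simp add: conjby_def[of d] D_def)
      ultimately show "Y \<in> commuting_conjugates u" by (simp add: commuting_conjugates_def)
    qed
    show "commuting_conjugates u \<subseteq> (\<lambda>d. conjby d X) ` D"
    proof
      fix Y assume Y: "Y \<in> commuting_conjugates u"
      then have YQ: "Y \<in> conjugates" and uY: "conjby u Y = Y"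
        by (simp_all add: commuting_conjugates_def)
      have YG: "Y \<in> carrier G" by (rule conjugates_carrier[OF YQ])
      \<comment> \<open>a fixed point \<open>d\<close> of the following map of period \<open>q\<close> satisfies \<open>d X d\<^sup>-\<^sup>1 = Y\<close>\<close>
      define f where "f d = inv Y \<otimes> d \<otimes> X" for d
      have f_iter: "(f ^^ n) d = inv Y [^] n \<otimes> d \<otimes> X [^] n" if "d \<in> carrier G" for n d
      proof (induction n)
        case (Suc n)
        have "inv Y [^] Suc n = inv Y \<otimes> inv Y [^] n" by (rule nat_pow_Suc2) (simp add: YG)
        then show ?case using Suc that XG YG by (simp add: f_def m_assoc)
      qed (simp add: that)
      have "card D mod q = card {d \<in> D. f d = d} mod q"
      proof (rule funpow_prime_fixpoints[OF q_prime])
        show "finite D" using finite_S by (simp add: D_def)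
        fix d assume d: "d \<in> D"
        have "f d = (inv Y \<otimes> X) \<otimes> (inv X \<otimes> d \<otimes> X)"
          using DG[OF d] XG YG by (simp add: f_def m_assoc)
        moreover have "inv X \<otimes> d \<otimes> X \<in> S"
        proof -
          have "conjby X ` S = S"
            using conjugates_normalize_S[OF XQ] finite_S XG S_carrier
            by (intro endo_inj_surj conjby_inj_on) auto
          then obtain c where "c \<in> S" "d = conjby X c" using d by (auto simp: D_def)
          then show ?thesis using XG S_carrier by (simp add: conjby_def m_assoc)
        qed
        ultimately have "f d \<in> S"
          using conjugates_diff[OF YQ XQ] subgroup.m_closed[OF S_subgroup] by simp
        moreover have "conjby u (f d) = f d"
          using d DG[OF d] XG YG uX uY by (simp add: f_def D_def)
        ultimately show "f d \<in> D" by (simp add: D_def)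
        show "(f ^^ q) d = d"
          using f_iter[OF DG[OF d]] DG[OF d] conjugates_pow[OF XQ] conjugates_pow[OF YQ] YG
          by (simp add: nat_pow_inv)
      qed
      moreover have "card D mod q \<noteq> 0"
      proof
        assume "card D mod q = 0"
        moreover obtain i where "card D = s ^ i"
          using prime_power_subgroup_of_S[OF D] by (auto simp: D_def)
        ultimately have "q dvd s ^ i" by (simp add: dvd_eq_mod_eq_0)
        then show False using coprime_q_s[of i] q_prime by (metis coprime_absorb_left not_prime_unit)
      qed
      ultimately have "{d \<in> D. f d = d} \<noteq> {}" by (metis card.empty mod_0)
      then obtain d where d: "d \<in> D" "inv Y \<otimes> d \<otimes> X = d" by (auto simp: f_def)
      have "Y \<otimes> (inv Y \<otimes> d \<otimes> X) = Y \<otimes> d" using d(2) by simp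
      then have "d \<otimes> X = Y \<otimes> d" using DG[OF d(1)] XG YG by (simp add: m_assoc)
      then have "conjby d X = Y" using DG[OF d(1)] XG YG by (simp add: conjby_def m_assoc)
      then show "Y \<in> (\<lambda>d. conjby d X) ` D" using d(1) by blast
    qed
  qed
qed

lemma card_commuting_conjugates:
  assumes u: "u \<in> carrier G" and ne: "commuting_conjugates u \<noteq> {}"
  shows "\<exists>i. card (commuting_conjugates u) = s ^ i" "card (commuting_conjugates u) mod q = 1"
proof -
  obtain X where X: "X \<in> commuting_conjugates u" using ne by blast
  define D where "D = {d \<in> S. conjby u d = d}"
  note t = commuting_conjugates_transitive[OF u X, folded D_def]
  have XQ: "X \<in> conjugates" and uX: "conjby u X = X"
    using X by (simp_all add: commuting_conjugates_def)
  have XG: "X \<in> carrier G" by (rule conjugates_carrier[OF XQ])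
  interpret u: group_hom G G "conjby u" by (rule conjby_group_hom[OF u])
  have "conjby X d \<in> D" if "d \<in> D" for d
  proof -
    have "conjby u (conjby X d) = conjby X d"
      using that uX XG S_carrier by (simp add: conjby_def[of X] D_def)
    then show ?thesis using that conjugates_normalize_S[OF XQ] by (simp add: D_def)
  qed
  then show "\<exists>i. card (commuting_conjugates u) = s ^ i" "card (commuting_conjugates u) mod q = 1"
    using card_conjugates_under_subgroup[OF t(1) _ XQ] t(2)
    by (auto simp: D_def commuting_conjugates_def)
qed

lemma card_commuting_conjugates_le:
  assumes u: "u \<in> carrier G" and ne: "commuting_conjugates u \<noteq> conjugates"
  shows "(q + 1) * card (commuting_conjugates u) \<le> card conjugates"
proof (cases "commuting_conjugates u = {}")
  case False
  obtain i where i: "card conjugates = s ^ i" using card_conjugates(1) by blast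
  obtain j where j: "card (commuting_conjugates u) = s ^ j"
    using card_commuting_conjugates(1)[OF u False] by blast
  have "commuting_conjugates u \<subset> conjugates" using ne by (auto simp: commuting_conjugates_def)
  then have "s ^ j < s ^ i" using psubset_card_mono[OF finite_conjugates] i j by metis
  then have ji: "j < i" using prime_gt_1_nat[OF s_prime] power_less_imp_less_exp by blast
  define r where "r = s ^ (i - j)"
  have r: "s ^ i = s ^ j * r" using ji by (simp add: r_def flip: power_add)
  have "1 = (s ^ j * r) mod q" using card_conjugates(2) i r by simp
  also have "\<dots> = ((s ^ j mod q) * r) mod q" by (simp add: mod_mult_left_eq)
  also have "s ^ j mod q = 1" using card_commuting_conjugates(2)[OF u False] j by simp
  finally have "r mod q = 1" by simp
  moreover have "r > 1"
    unfolding r_def using ji prime_gt_1_nat[OF s_prime] by (intro one_less_power) auto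
  ultimately have "r \<ge> q + 1"
    by (metis Suc_eq_plus1 Suc_leI le_neq_implies_less linorder_not_le mod_less mod_self less_irrefl zero_neq_one)
  then have "(q + 1) * s ^ j \<le> r * s ^ j" by (rule mult_le_mono1)
  then show ?thesis using i j r by (simp add: mult.commute)
qed simp

end

section \<open>Counting commuting pairs\<close>

context group
begin

lemma pi_elements_conjby:
  "u \<in> pi_elements \<pi> G \<Longrightarrow> g \<in> carrier G \<Longrightarrow> conjby g u \<in> pi_elements \<pi> G"
  by (simp add: pi_elements_def ord_conjby)

lemma pi_elements_mult:
  assumes u: "u \<in> pi_elements \<pi> G" and v: "v \<in> pi_elements \<pi> G" and comm: "u \<otimes> v = v \<otimes> u"
  shows "u \<otimes> v \<in> pi_elements \<pi> G"
  unfolding pi_elements_def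
proof (intro CollectI conjI allI impI)
  show "u \<otimes> v \<in> carrier G" using u v by (simp add: pi_elements_def)
  fix p :: nat assume p: "prime p" "p dvd ord (u \<otimes> v)"
  have "ord (u \<otimes> v) dvd ord u * ord v"
    using u v by (intro ord_mul_divides comm) (simp_all add: pi_elements_def)
  then have "p dvd ord u * ord v" using p(2) dvd_trans by blast
  then have "p dvd ord u \<or> p dvd ord v" using p(1) by (simp add: prime_dvd_mult_iff)
  then show "p \<in> \<pi>" using u v p(1) by (auto simp: pi_elements_def)
qed

lemma pi_elements_pow:
  assumes u: "u \<in> pi_elements \<pi> G"
  shows "u [^] (n::nat) \<in> pi_elements \<pi> G"
  unfolding pi_elements_def
proof (intro CollectI conjI allI impI)
  have uG: "u \<in> carrier G" using u by (simp add: pi_elements_def)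
  then show "u [^] n \<in> carrier G" by simp
  fix p :: nat assume p: "prime p" "p dvd ord (u [^] n)"
  have "(u [^] n) [^] ord u = (u [^] ord u) [^] n" using uG by (simp only: nat_pow_pow mult.commute)
  then have "(u [^] n) [^] ord u = \<one>" using uG by simp
  then have "ord (u [^] n) dvd ord u" using uG by (simp flip: pow_eq_id)
  then have "p dvd ord u" using p(2) dvd_trans by blast
  then show "p \<in> \<pi>" using u p(1) by (simp add: pi_elements_def)
qed

lemma subgroup_centralizer: "y \<in> carrier G \<Longrightarrow> subgroup (centralizer G y) G"
proof (rule subgroupI)
  assume y: "y \<in> carrier G"
  interpret y: group_hom G G "conjby y" by (rule conjby_group_hom[OF y])
  have mem: "g \<in> centralizer G y \<longleftrightarrow> g \<in> carrier G \<and> conjby y g = g" for g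
  proof (cases "g \<in> carrier G")
    case True
    then have "conjby y g = g \<longleftrightarrow> y \<otimes> g = g \<otimes> y" using y conjby_eq_iff_commute by blast
    then show ?thesis using True unfolding centralizer_def by auto
  qed (simp add: centralizer_def)
  have "\<one> \<in> centralizer G y" by (simp add: mem)
  then show "centralizer G y \<noteq> {}" by blast
  show "centralizer G y \<subseteq> carrier G" by (auto simp: centralizer_def)
  show "inv a \<in> centralizer G y" if "a \<in> centralizer G y" for a
    using that by (simp add: mem)
  show "a \<otimes> b \<in> centralizer G y" if "a \<in> centralizer G y" "b \<in> centralizer G y" for a b
    using that by (simp add: mem)
qed

lemma ord_restrict:
  assumes "subgroup H G" "u \<in> H"
  shows "group.ord (G\<lparr>carrier := H\<rparr>) u = ord u"
  by (simp add: group.ord_def[OF subgroup_imp_group[OF assms(1)]] ord_def nat_pow_def)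

lemma pi_elements_restrict:
  assumes "subgroup H G"
  shows "pi_elements \<pi> (G\<lparr>carrier := H\<rparr>) = pi_elements \<pi> G \<inter> H"
  using ord_restrict[OF assms] subgroup.mem_carrier[OF assms] by (auto simp: pi_elements_def)

lemma pi_elements_centralizer:
  assumes "y \<in> carrier G"
  shows "pi_elements \<pi> (G\<lparr>carrier := centralizer G y\<rparr>) = {u \<in> pi_elements \<pi> G. conjby u y = y}"
proof -
  have "u \<in> centralizer G y \<longleftrightarrow> conjby u y = y" if "u \<in> pi_elements \<pi> G" for u
    using that assms by (simp add: centralizer_def conjby_eq_iff_commute pi_elements_def)
  then show ?thesis using pi_elements_restrict[OF subgroup_centralizer[OF assms]] by blast
qed

end

context coprime_prime_action
begin

lemma pow_commute_conjugates_eq: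
  assumes X: "X \<in> conjugates" and Y: "Y \<in> conjugates"
    and d: "0 < d" "d < q" and comm: "conjby (X [^] d) Y = Y"
  shows "X = Y"
proof -
  have XY: "X \<in> carrier G" "Y \<in> carrier G" using X Y conjugates_carrier by auto
  have "coprime d q"
    using d q_prime by (metis coprime_commute nat_dvd_not_less prime_imp_coprime)
  then have "gcd d q = 1" by simp
  then obtain a b where ab: "d * a = q * b + 1" using bezout_nat[of d q] d(1) by (metis not_gr_zero)
  have "(X [^] d) [^] a = (X [^] q) [^] b \<otimes> X"
    using XY by (simp add: nat_pow_pow ab)
  then have "(X [^] d) [^] a = X" using XY conjugates_pow[OF X] by simp
  then have "conjby X Y = Y" using pow_fixed[of "X [^] d" Y a] comm XY by simp
  then show ?thesis by (rule commuting_conjugates_eq[OF X Y])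
qed

lemma card_commuting_with_two_conjugates:
  assumes q\<pi>: "q \<in> \<pi>" and X: "X \<in> conjugates" and Y: "Y \<in> conjugates" and ne: "X \<noteq> Y"
  shows "q * card {u \<in> pi_elements \<pi> G. conjby u X = X \<and> conjby u Y = Y}
    \<le> card {u \<in> pi_elements \<pi> G. conjby u X = X}"
proof -
  define A where "A = {u \<in> pi_elements \<pi> G. conjby u X = X \<and> conjby u Y = Y}"
  define B where "B = {u \<in> pi_elements \<pi> G. conjby u X = X}"
  have XY: "X \<in> carrier G" "Y \<in> carrier G" using X Y conjugates_carrier by auto
  have PG: "u \<in> carrier G" if "u \<in> pi_elements \<pi> G" for u using that by (simp add: pi_elements_def)
  have finB: "finite B"
    by (rule finite_subset[OF _ finite_carrier]) (auto simp: B_def PG)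
  have "ord X dvd q" using XY conjugates_pow[OF X] by (simp flip: pow_eq_id)
  then have X\<pi>: "X \<in> pi_elements \<pi> G"
    using XY q\<pi> q_prime primes_dvd_imp_eq dvd_trans unfolding pi_elements_def by blast
  have XX: "conjby X X = X" using XY by (simp add: conjby_eq_iff_commute)
  let ?f = "\<lambda>(i::nat, u). X [^] i \<otimes> u"
  have comm: "X [^] i \<otimes> u = u \<otimes> X [^] i" if "u \<in> carrier G" "conjby u X = X" for i :: nat and u
    using that XY group_commutes_pow[of X u i] by (simp add: conjby_eq_iff_commute)
  have "?f ` ({..<q} \<times> A) \<subseteq> B"
  proof
    fix w assume "w \<in> ?f ` ({..<q} \<times> A)"
    then obtain a where a: "a \<in> {..<q} \<times> A" "w = ?f a" by blast
    obtain i u where "a = (i, u)" by (rule prod.exhaust)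
    then have u: "u \<in> A" "w = X [^] i \<otimes> u" using a by simp_all
    have uG: "u \<in> carrier G" using u by (simp add: A_def PG)
    have "w \<in> pi_elements \<pi> G"
      unfolding u(2) using u uG by (intro pi_elements_mult pi_elements_pow X\<pi> comm) (auto simp: A_def)
    moreover have "conjby w X = X"
      using u uG XY pow_fixed[OF XY(1) XY(1) XX, of i] by (simp add: A_def flip: conjby_conjby)
    ultimately show "w \<in> B" by (simp add: B_def)
  qed
  moreover have "inj_on ?f ({..<q} \<times> A)"
  proof -
    have key: "i = j \<and> u = v"
      if ij: "i \<le> j" "j < q" and uv: "u \<in> A" "v \<in> A" and eq: "X [^] i \<otimes> u = X [^] j \<otimes> v" for i j u v
    proof -
      have uvG: "u \<in> carrier G" "v \<in> carrier G" using uv by (simp_all add: A_def PG)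
      have "X [^] j = X [^] i \<otimes> X [^] (j - i)" using ij XY by (simp add: nat_pow_mult)
      then have u: "u = X [^] (j - i) \<otimes> v" using eq XY uvG by (simp add: m_assoc)
      have "conjby (X [^] (j - i)) Y = conjby (X [^] (j - i)) (conjby v Y)"
        using uv by (simp add: A_def)
      also have "\<dots> = conjby u Y" using u uvG XY by (simp add: conjby_conjby)
      also have "\<dots> = Y" using uv by (simp add: A_def)
      finally have "\<not> 0 < j - i" using pow_commute_conjugates_eq[OF X Y, of "j - i"] ij ne by linarith
      then have "i = j" using ij by simp
      then show ?thesis using u uvG by simp
    qed
    show ?thesis
    proof (rule inj_onI)
      fix a b assume ab: "a \<in> {..<q} \<times> A" "b \<in> {..<q} \<times> A" "?f a = ?f b"
      obtain i u where a: "a = (i, u)" by (rule prod.exhaust)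
      obtain j v where b: "b = (j, v)" by (rule prod.exhaust)
      show "a = b"
        using ab key[of i j u v] key[of j i v u] unfolding a b by (cases "i \<le> j") simp_all
    qed
  qed
  ultimately have "card ({..<q} \<times> A) \<le> card B" using finB card_inj_on_le by blast
  then show ?thesis by (simp add: A_def B_def card_cartesian_product)
qed

lemma card_commuting_with_conjugate:
  assumes "X \<in> conjugates"
  shows "card {u \<in> pi_elements \<pi> G. conjby u X = X} = card {u \<in> pi_elements \<pi> G. conjby u x = x}"
proof -
  obtain n where "n \<in> S" "X = conjby n x" using assms by (auto simp: conjugates_def)
  then have n: "n \<in> carrier G" "X = conjby n x" using S_carrier by auto
  have PG: "u \<in> carrier G" if "u \<in> pi_elements \<pi> G" for u using that by (simp add: pi_elements_def)
  have "bij_betw (conjby n) {u \<in> pi_elements \<pi> G. conjby u x = x} {u \<in> pi_elements \<pi> G. conjby u X = X}"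
  proof (rule bij_betw_byWitness[where f' = "conjby (inv n)"])
    have "conjby (conjby n u) X = conjby n (conjby u x)" if "u \<in> carrier G" for u
      using that n x_in by (simp add: conjby_def m_assoc inv_mult_group)
    then show "conjby n ` {u \<in> pi_elements \<pi> G. conjby u x = x} \<subseteq> {u \<in> pi_elements \<pi> G. conjby u X = X}"
      using n pi_elements_conjby PG by auto
    have "conjby (conjby (inv n) u) x = conjby (inv n) (conjby u X)" if "u \<in> carrier G" for u
      using that n x_in by (simp add: conjby_def m_assoc inv_mult_group)
    then show "conjby (inv n) ` {u \<in> pi_elements \<pi> G. conjby u X = X} \<subseteq> {u \<in> pi_elements \<pi> G. conjby u x = x}"
      using n pi_elements_conjby PG x_in by auto
  qed (use n PG in auto)
  from bij_betw_same_card[OF this] show ?thesis by simp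
qed

lemma card_pi_centralizer_le:
  assumes q\<pi>: "q \<in> \<pi>" and t: "t \<in> S" "conjby x t \<noteq> t"
  shows "q * card {u \<in> pi_elements \<pi> G. conjby u x = x} \<le> card (pi_elements \<pi> G)"
proof -
  define P where "P = pi_elements \<pi> G"
  define m where "m = card {u \<in> P. conjby u x = x}"
  define K where "K = {u \<in> P. commuting_conjugates u = conjugates}"
  have PG: "u \<in> carrier G" if "u \<in> P" for u using that by (simp add: P_def pi_elements_def)
  have finP: "finite P" by (rule finite_subset[OF _ finite_carrier]) (auto simp: PG)
  have tG: "t \<in> carrier G" by (rule S_carrier[OF t(1)])
  have "conjby t x \<noteq> x" using t(2) conjby_eq_self_sym[OF x_in tG] by simp
  moreover have tx: "conjby t x \<in> conjugates" using t(1) by (simp add: conjugates_def)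
  ultimately have "q * card {u \<in> P. conjby u x = x \<and> conjby u (conjby t x) = conjby t x} \<le> m"
    unfolding P_def m_def
    using card_commuting_with_two_conjugates[OF q\<pi> x_conjugate tx] by simp
  moreover have "card K \<le> card {u \<in> P. conjby u x = x \<and> conjby u (conjby t x) = conjby t x}"
  proof (rule card_mono)
    have "conjby u X = X" if "u \<in> K" "X \<in> conjugates" for u X
      using that unfolding K_def commuting_conjugates_def by blast
    then show "K \<subseteq> {u \<in> P. conjby u x = x \<and> conjby u (conjby t x) = conjby t x}"
      using x_conjugate tx by (auto simp: K_def)
  qed (use finP in simp)
  ultimately have Km: "q * card K \<le> m" by (meson le_trans mult_le_mono2)
  let ?c = "\<lambda>u. card (commuting_conjugates u)"
  define k where "k = card conjugates"
  have k0: "k > 0" unfolding k_def using finite_conjugates x_conjugate card_gt_0_iff by blast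
  have "(\<Sum>u\<in>P. ?c u) = (\<Sum>u\<in>P. \<Sum>X\<in>conjugates. if conjby u X = X then 1 else 0)"
    by (simp add: commuting_conjugates_def finite_conjugates Int_def flip: sum.inter_filter)
  also have "\<dots> = (\<Sum>X\<in>conjugates. \<Sum>u\<in>P. if conjby u X = X then 1 else 0)" by (rule sum.swap)
  also have "\<dots> = (\<Sum>X\<in>conjugates. m)"
    using card_commuting_with_conjugate[of _ \<pi>, folded P_def m_def]
    by (intro sum.cong refl) (simp add: m_def finP flip: sum.inter_filter)
  finally have total: "(\<Sum>u\<in>P. ?c u) = k * m" by (simp add: k_def)
  have KP: "K \<subseteq> P" by (auto simp: K_def)
  have "(\<Sum>u\<in>P. ?c u) = (\<Sum>u\<in>P - K. ?c u) + (\<Sum>u\<in>K. ?c u)"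
    by (rule sum.subset_diff[OF KP finP])
  moreover have "(\<Sum>u\<in>K. ?c u) = k * card K" by (simp add: K_def k_def)
  moreover have "(q + 1) * (\<Sum>u\<in>P - K. ?c u) \<le> (\<Sum>u\<in>P - K. k)"
    unfolding sum_distrib_left k_def
  proof (rule sum_mono)
    fix u assume "u \<in> P - K"
    then have "u \<in> carrier G" "commuting_conjugates u \<noteq> conjugates" using PG by (auto simp: K_def)
    then show "(q + 1) * ?c u \<le> card conjugates" by (rule card_commuting_conjugates_le)
  qed
  ultimately have "(q + 1) * (k * m) \<le> k * card (P - K) + (q + 1) * (k * card K)"
    using total by (simp add: algebra_simps)
  then have "k * ((q + 1) * m) \<le> k * (card (P - K) + (q + 1) * card K)"
    by (simp add: algebra_simps)
  then have "(q + 1) * m \<le> card (P - K) + (q + 1) * card K" using k0 by simp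
  moreover have "card (P - K) + card K = card P"
    using card_Diff_subset[OF finite_subset[OF KP finP] KP] card_mono[OF finP KP] by simp
  ultimately have "q * m \<le> card P" using Km by (simp add: algebra_simps)
  then show ?thesis by (simp add: P_def m_def)
qed

end

context group
begin

lemma card_pi_centralizer_of_pi_element_le:
  assumes fin: "finite (carrier G)" and x: "x \<in> pi_elements \<pi> G"
    and q: "prime q" and qx: "q dvd ord x" and qF: "\<not> q dvd card (generalized_fitting G)"
  shows "q * card {u \<in> pi_elements \<pi> G. conjby u x = x} \<le> card (pi_elements \<pi> G)"
proof -
  have xG: "x \<in> carrier G" using x by (simp add: pi_elements_def)
  have q\<pi>: "q \<in> \<pi>" using x q qx by (simp add: pi_elements_def)
  define F where "F = generalized_fitting G"
  have F: "F \<lhd> G" unfolding F_def by (rule generalized_fitting_normal)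
  have qF: "\<not> q dvd card F" using qF by (simp add: F_def)
  have ordx: "ord x > 0" using ord_ge_1[OF fin xG] by simp
  obtain r where r: "ord x = q * r" using qx by blast
  define y where "y = x [^] r"
  have yG: "y \<in> carrier G" using xG by (simp add: y_def)
  have yq: "y [^] q = \<one>" using xG r by (simp add: y_def nat_pow_pow pow_eq_id mult.commute)
  have "y \<notin> F"
  proof
    assume y: "y \<in> F"
    let ?F = "G\<lparr>carrier := F\<rparr>"
    interpret F: group ?F by (rule subgroup_imp_group[OF normal_imp_subgroup[OF F]])
    have "ord y dvd q" using yG yq by (simp flip: pow_eq_id)
    moreover have "ord y \<noteq> 1"
    proof
      assume "ord y = 1"
      then have "x [^] r = \<one>" using yG ord_eq_1 by (simp add: y_def)
      then have "q * r dvd r" using xG r by (simp add: pow_eq_id)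
      then show False using r ordx prime_gt_1_nat[OF q] by (auto dest: dvd_imp_le)
    qed
    ultimately have "ord y = q" using q by (metis prime_nat_iff)
    moreover have "F.ord y dvd order ?F" by (rule F.ord_dvd_group_order) (simp add: y)
    ultimately have "q dvd card F"
      using ord_restrict[OF normal_imp_subgroup[OF F] y] by (simp add: order_def)
    then show False using qF by blast
  qed
  then have "y \<notin> set_centralizer F"
    using set_centralizer_generalized_fitting_subset[OF fin] by (auto simp: F_def)
  then obtain n where n: "n \<in> F" "conjby y n \<noteq> n" using yG by (auto simp: set_centralizer_def)
  obtain s k S t where S: "prime s" "s \<noteq> q" "subgroup S G" "card S = s ^ k" "conjby y ` S = S"
    and t: "t \<in> S" "conjby y t \<noteq> t"
    using coprime_action_nontrivial_on_prime_power_subgroup[OF fin F q qF yG yq n] .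
  interpret A: coprime_prime_action G y q s k S
    by (intro coprime_prime_action.intro coprime_prime_action_axioms.intro is_group fin q yG yq S)
  have finP: "finite (pi_elements \<pi> G)"
    by (rule finite_subset[OF _ fin]) (auto simp: pi_elements_def)
  have "card {u \<in> pi_elements \<pi> G. conjby u x = x} \<le> card {u \<in> pi_elements \<pi> G. conjby u y = y}"
  proof (rule card_mono)
    have "conjby u y = y" if "u \<in> carrier G" "conjby u x = x" for u
      using that xG by (simp add: y_def conjby_pow)
    then show "{u \<in> pi_elements \<pi> G. conjby u x = x} \<subseteq> {u \<in> pi_elements \<pi> G. conjby u y = y}"
      by (auto simp: pi_elements_def)
  qed (use finP in simp)
  then show ?thesis using A.card_pi_centralizer_le[OF q\<pi> t] by (meson le_trans mult_le_mono2)
qed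

end

theorem theoremB:
  fixes G :: "('a, 'b) monoid_scheme" and \<pi> :: "nat set" and x :: 'a and q :: nat
  assumes "\<And>p. p \<in> \<pi> \<Longrightarrow> prime p"
    and "group G" and "finite (carrier G)"
    and "pi_complement_group \<pi> (G\<lparr>carrier := generalized_fitting G\<rparr>)"
    and "x \<in> pi_elements \<pi> G" and "x \<noteq> \<one>\<^bsub>G\<^esub>"
    and "prime q" and "q dvd group.ord G x"
    and "\<And>p. prime p \<Longrightarrow> p dvd group.ord G x \<Longrightarrow> p \<le> q"
  shows "real (card (pi_elements \<pi> (G\<lparr>carrier := centralizer G x\<rparr>)))
           / real (card (pi_elements \<pi> G)) \<le> 1 / real q"
proof -
  interpret group G by fact
  have xG: "x \<in> carrier G" using assms(5) by (simp add: pi_elements_def)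
  have "q \<in> \<pi>" using assms(5,7,8) by (simp add: pi_elements_def)
  then have "\<not> q dvd card (generalized_fitting G)"
    using assms(4) by (simp add: pi_complement_group_def order_def)
  from card_pi_centralizer_of_pi_element_le[OF assms(3,5,7,8) this]
  have "real q * real (card (pi_elements \<pi> (G\<lparr>carrier := centralizer G x\<rparr>)))
      \<le> real (card (pi_elements \<pi> G))"
    unfolding pi_elements_centralizer[OF xG] by (simp flip: of_nat_mult)
  moreover have "finite (pi_elements \<pi> G)"
    by (rule finite_subset[OF _ assms(3)]) (auto simp: pi_elements_def)
  then have "card (pi_elements \<pi> G) > 0" using assms(5) card_gt_0_iff by blast
  ultimately show ?thesis using prime_gt_0_nat[OF assms(7)] by (simp add: field_simps)
qed

end
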